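(* Let $H$ be a Hopf $*$-algebra over $\mathbb{C}$ and let $V,W$ be left $H$-modules. (a) The map $b_V:V^*\to{}^*(\overline V)$ given by $b_V(f)(\bar v)=\overline{f(v)}$ (complex conjugate in $\mathbb{C}$) is a bijective antimodule map. (b) The map $\beta_V:\overline{V^*}\to{}^*(\overline V)$ given by $\beta_V=b_V\circ c_{V^*}^{-1}$ is an isomorphism of $H$-modules. (c) For any $H$-module map $T:V\to W$, one has $\beta_V\circ\overline{T^{\mathrm{tr}}}=(\overline T)^{\mathrm{tr}}\circ\beta_W$ as maps $\overline{W^*}\to{}^*(\overline V)$. (d) The collection of maps $(\beta_V)$ is a natural equivalence of the contravariant endofunctors of $\mathbf{HMod}$ (the category of left $H$-modules and module maps) given by left dual followed by conjugation, and conjugation followed by right dual, respectively.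
   Context: All vector spaces are over $\mathbb{C}$. A Hopf $*$-algebra is a Hopf algebra $H$ over $\mathbb{C}$ (coproduct $\Delta(a)=a_{(1)}\otimes a_{(2)}$, counit $\varepsilon$, antipode $S$) equipped with an antilinear map $*:H\to H$ such that $(a^* )^*=a$, $(ab)^*=b^*a^*$ and $\Delta(a^* )=a_{(1)}^*\otimes a_{(2)}^*$. Its antipode is automatically invertible, with $S^{-1}(a)=S(a^* )^*$. For a vector space $V$, the complex conjugate vector space $\overline{V}$ consists of formal symbols $c_V(v)=\bar v$ ($v\in V$) with $\bar v+\bar w=\overline{v+w}$ and $\lambda\cdot\bar v=\overline{\bar\lambda v}$. For a linear map $T:V\to W$, $\overline T(\bar v)=\overline{T(v)}$, and $T^{\mathrm{tr}}:\mathrm{Hom}(W,\mathbb{C})\to\mathrm{Hom}(V,\mathbb{C})$ is the transpose $f\mapsto f\circ T$. If $V$ is a left $H$-module, $\overline V$ is a left $H$-module via $a\rhd\bar v=\overline{S(a)^*\rhd v}$. For a left $H$-module $V$: the left dual $V^*$ is $\mathrm{Hom}(V,\mathbb{C})$ with the action $(a\rhd f)(v)=f(S(a)\rhd v)$; the right dual ${}^*V$ is $\mathrm{Hom}(V,\mathbb{C})$ with the action $(a\blacktriangleright f)(v)=f(S^{-1}(a)\rhd v)$. Both duals act on morphisms by transpose. An antimodule map $T:V\to W$ between left $H$-modules is an antilinear map with $T(a\rhd v)=S(a)^*\rhd T(v)$ for all $a\in H$, $v\in V$ (where the action on the target is that of the target module). *)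

theory Defs
  imports "HOL-Algebra.Module" "HOL-Library.FuncSet" Complex_Main
begin

section \<open>Complex vector spaces\<close>

text \<open>A complex vector space is a module over the field below, in the sense of HOL-Algebra.  The
  record type of HOL-Algebra modules also carries the fields \<open>mult\<close> and \<open>one\<close>; they are
  irrelevant for vector spaces, and are \<open>undefined\<close> in the constructions of this theory.  Only for
  the Hopf algebra itself do they have a meaning.\<close>

definition cplx :: "(complex, complex) module"
  where "cplx = \<lparr>carrier = UNIV, mult = (*), one = 1, zero = 0, add = (+), smult = (*)\<rparr>"

definition linear_on ::
  "(complex, 'v, 'x) module_scheme \<Rightarrow> (complex, 'w, 'y) module_scheme \<Rightarrow> ('v \<Rightarrow> 'w) \<Rightarrow> bool"
  where "linear_on V W f \<longleftrightarrow>
    f \<in> carrier V \<rightarrow> carrier W \<and>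
    (\<forall>u\<in>carrier V. \<forall>v\<in>carrier V. f (u \<oplus>\<^bsub>V\<^esub> v) = f u \<oplus>\<^bsub>W\<^esub> f v) \<and>
    (\<forall>c. \<forall>v\<in>carrier V. f (c \<odot>\<^bsub>V\<^esub> v) = c \<odot>\<^bsub>W\<^esub> f v)"

definition antilinear_on ::
  "(complex, 'v, 'x) module_scheme \<Rightarrow> (complex, 'w, 'y) module_scheme \<Rightarrow> ('v \<Rightarrow> 'w) \<Rightarrow> bool"
  where "antilinear_on V W f \<longleftrightarrow>
    f \<in> carrier V \<rightarrow> carrier W \<and>
    (\<forall>u\<in>carrier V. \<forall>v\<in>carrier V. f (u \<oplus>\<^bsub>V\<^esub> v) = f u \<oplus>\<^bsub>W\<^esub> f v) \<and>
    (\<forall>c. \<forall>v\<in>carrier V. f (c \<odot>\<^bsub>V\<^esub> v) = cnj c \<odot>\<^bsub>W\<^esub> f v)"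

text \<open>Members of hom-sets are extensional functions, so that equality of morphisms is equality of
  functions on the underlying sets.\<close>

definition lin_hom ::
  "(complex, 'v, 'x) module_scheme \<Rightarrow> (complex, 'w, 'y) module_scheme \<Rightarrow> ('v \<Rightarrow> 'w) set"
  where "lin_hom V W = {f \<in> extensional (carrier V). linear_on V W f}"


section \<open>Tensor products\<close>

text \<open>The tensor product over the complex numbers is the abelian group generated by the symbols
  \<open>v \<otimes> w\<close>, subject to biadditivity and to \<open>(c v) \<otimes> w = v \<otimes> (c w)\<close>.  A list of pairs stands for
  the sum of the corresponding symbols, and an element of the tensor product is a class of lists.\<close>

inductive tensor_eq ::
  "(complex, 'v, 'x) module_scheme \<Rightarrow> (complex, 'w, 'y) module_scheme
    \<Rightarrow> ('v \<times> 'w) list \<Rightarrow> ('v \<times> 'w) list \<Rightarrow> bool"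
  for V W
  where
    refl: "set ps \<subseteq> carrier V \<times> carrier W \<Longrightarrow> tensor_eq V W ps ps"
  | sym: "tensor_eq V W ps qs \<Longrightarrow> tensor_eq V W qs ps"
  | trans: "tensor_eq V W ps qs \<Longrightarrow> tensor_eq V W qs rs \<Longrightarrow> tensor_eq V W ps rs"
  | append: "tensor_eq V W ps ps' \<Longrightarrow> tensor_eq V W qs qs' \<Longrightarrow> tensor_eq V W (ps @ qs) (ps' @ qs')"
  | comm: "set ps \<subseteq> carrier V \<times> carrier W \<Longrightarrow> set qs \<subseteq> carrier V \<times> carrier W \<Longrightarrow>
      tensor_eq V W (ps @ qs) (qs @ ps)"
  | add_left: "v \<in> carrier V \<Longrightarrow> v' \<in> carrier V \<Longrightarrow> w \<in> carrier W \<Longrightarrow>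
      tensor_eq V W [(v \<oplus>\<^bsub>V\<^esub> v', w)] [(v, w), (v', w)]"
  | add_right: "v \<in> carrier V \<Longrightarrow> w \<in> carrier W \<Longrightarrow> w' \<in> carrier W \<Longrightarrow>
      tensor_eq V W [(v, w \<oplus>\<^bsub>W\<^esub> w')] [(v, w), (v, w')]"
  | zero: "w \<in> carrier W \<Longrightarrow> tensor_eq V W [(\<zero>\<^bsub>V\<^esub>, w)] []"
  | balanced: "v \<in> carrier V \<Longrightarrow> w \<in> carrier W \<Longrightarrow>
      tensor_eq V W [(c \<odot>\<^bsub>V\<^esub> v, w)] [(v, c \<odot>\<^bsub>W\<^esub> w)]"

definition tensor_class ::
  "(complex, 'v, 'x) module_scheme \<Rightarrow> (complex, 'w, 'y) module_scheme
    \<Rightarrow> ('v \<times> 'w) list \<Rightarrow> ('v \<times> 'w) list set"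
  where "tensor_class V W ps = {qs. tensor_eq V W ps qs}"

definition tensor ::
  "(complex, 'v, 'x) module_scheme \<Rightarrow> (complex, 'w, 'y) module_scheme
    \<Rightarrow> (complex, ('v \<times> 'w) list set) module"
  where "tensor V W =
    \<lparr>carrier = tensor_class V W ` {ps. set ps \<subseteq> carrier V \<times> carrier W},
     mult = undefined, one = undefined,
     zero = tensor_class V W [],
     add = (\<lambda>s t. \<Union>ps\<in>s. \<Union>qs\<in>t. tensor_class V W (ps @ qs)),
     smult = (\<lambda>c t. \<Union>ps\<in>t. tensor_class V W (map (\<lambda>(v, w). (c \<odot>\<^bsub>V\<^esub> v, w)) ps))\<rparr>"

definition pure_tensor ::
  "(complex, 'v, 'x) module_scheme \<Rightarrow> (complex, 'w, 'y) module_scheme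
    \<Rightarrow> 'v \<Rightarrow> 'w \<Rightarrow> ('v \<times> 'w) list set"
  where "pure_tensor V W v w = tensor_class V W [(v, w)]"

text \<open>The operations of \<^const>\<open>tensor\<close> are independent of representatives and form a vector space.\<close>

context
  fixes V :: "(complex, 'v, 'x) module_scheme" and W :: "(complex, 'w, 'y) module_scheme"
  assumes V: "Module.module cplx V" and W: "Module.module cplx W"
begin

interpretation V: Module.module cplx V by (rule V)
interpretation W: Module.module cplx W by (rule W)

private abbreviation "FS \<equiv> {ps. set ps \<subseteq> carrier V \<times> carrier W}"

private lemma ceq: "tensor_class V W ps = tensor_class V W qs" if "tensor_eq V W ps qs"
proof -
  have "tensor_eq V W ps rs \<longleftrightarrow> tensor_eq V W qs rs" for rs
    using tensor_eq.trans[OF that, of rs] tensor_eq.trans[OF tensor_eq.sym[OF that], of rs] by blast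
  then show ?thesis by (simp only: tensor_class_def)
qed

private lemma cscale: "c \<odot>\<^bsub>V\<^esub> v \<in> carrier V" if "v \<in> carrier V"
  by (rule V.smult_closed) (simp_all add: that cplx_def)

private lemma cscale2: "c \<odot>\<^bsub>W\<^esub> v \<in> carrier W" if "v \<in> carrier W"
  by (rule W.smult_closed) (simp_all add: that cplx_def)

lemma tensor_add_class:
  assumes "set ps \<subseteq> carrier V \<times> carrier W" "set qs \<subseteq> carrier V \<times> carrier W"
  shows "tensor_class V W ps \<oplus>\<^bsub>tensor V W\<^esub> tensor_class V W qs = tensor_class V W (ps @ qs)"
proof -
  have "tensor_class V W (ps' @ qs') = tensor_class V W (ps @ qs)"
    if "ps' \<in> tensor_class V W ps" "qs' \<in> tensor_class V W qs" for ps' qs'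
    using that[unfolded tensor_class_def mem_Collect_eq]
    by (rule ceq[OF tensor_eq.sym[OF tensor_eq.append]])
  moreover have "ps \<in> tensor_class V W ps" "qs \<in> tensor_class V W qs"
    using tensor_eq.refl assms unfolding tensor_class_def mem_Collect_eq by blast+
  ultimately have "(\<Union>ps'\<in>tensor_class V W ps. \<Union>qs'\<in>tensor_class V W qs. tensor_class V W (ps' @ qs')) = tensor_class V W (ps @ qs)"
    by blast
  then show ?thesis
    by (simp add: tensor_def)
qed

private lemma scale_eq:
  assumes "tensor_eq V W ps qs"
  shows "tensor_eq V W (map (\<lambda>(v, w). (c \<odot>\<^bsub>V\<^esub> v, w)) ps) (map (\<lambda>(v, w). (c \<odot>\<^bsub>V\<^esub> v, w)) qs)"
  using assms
proof induction
  case (refl ps)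
  then show ?case by (intro tensor_eq.refl) (auto intro: cscale)
next
  case (comm ps qs)
  have "tensor_eq V W (map (\<lambda>(v, w). (c \<odot>\<^bsub>V\<^esub> v, w)) ps @ map (\<lambda>(v, w). (c \<odot>\<^bsub>V\<^esub> v, w)) qs)
       (map (\<lambda>(v, w). (c \<odot>\<^bsub>V\<^esub> v, w)) qs @ map (\<lambda>(v, w). (c \<odot>\<^bsub>V\<^esub> v, w)) ps)"
    by (rule tensor_eq.comm) (use comm in \<open>auto intro: cscale\<close>)
  then show ?case by simp
next
  case (sym ps qs) then show ?case by (metis tensor_eq.sym)
next
  case (trans ps qs rs) then show ?case by (metis tensor_eq.trans)
next
  case (append ps ps' qs qs') then show ?case by (simp add: tensor_eq.append)
next
  case (add_left v v' w)
  have "c \<odot>\<^bsub>V\<^esub> (v \<oplus>\<^bsub>V\<^esub> v') = c \<odot>\<^bsub>V\<^esub> v \<oplus>\<^bsub>V\<^esub> c \<odot>\<^bsub>V\<^esub> v'"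
    by (rule V.smult_r_distr) (use add_left in \<open>auto simp: cplx_def\<close>)
  then show ?case using add_left by (simp add: tensor_eq.add_left cscale)
next
  case (add_right v w w') then show ?case by (simp add: tensor_eq.add_right cscale)
next
  case (zero w)
  have "c \<odot>\<^bsub>V\<^esub> \<zero>\<^bsub>V\<^esub> = \<zero>\<^bsub>V\<^esub>" by (rule V.smult_r_null) (simp add: cplx_def)
  then show ?case using zero by (simp add: tensor_eq.zero)
next
  case (balanced v w d)
  have "c \<odot>\<^bsub>V\<^esub> (d \<odot>\<^bsub>V\<^esub> v) = d \<odot>\<^bsub>V\<^esub> (c \<odot>\<^bsub>V\<^esub> v)"
    using V.smult_assoc1[of c d v] V.smult_assoc1[of d c v] balanced
    by (simp add: cplx_def mult.commute)
  then show ?case using balanced by (simp add: tensor_eq.balanced cscale)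
qed

lemma tensor_smult_class:
  assumes "set ps \<subseteq> carrier V \<times> carrier W"
  shows "c \<odot>\<^bsub>tensor V W\<^esub> tensor_class V W ps = tensor_class V W (map (\<lambda>(v, w). (c \<odot>\<^bsub>V\<^esub> v, w)) ps)"
proof -
  have "tensor_class V W (map (\<lambda>(v, w). (c \<odot>\<^bsub>V\<^esub> v, w)) ps') = tensor_class V W (map (\<lambda>(v, w). (c \<odot>\<^bsub>V\<^esub> v, w)) ps)"
    if "ps' \<in> tensor_class V W ps" for ps'
    using that[unfolded tensor_class_def mem_Collect_eq]
    by (rule ceq[OF tensor_eq.sym[OF scale_eq]])
  moreover have "ps \<in> tensor_class V W ps"
    using tensor_eq.refl assms unfolding tensor_class_def mem_Collect_eq by blast+
  ultimately have "(\<Union>ps'\<in>tensor_class V W ps. tensor_class V W (map (\<lambda>(v, w). (c \<odot>\<^bsub>V\<^esub> v, w)) ps')) = tensor_class V W (map (\<lambda>(v, w). (c \<odot>\<^bsub>V\<^esub> v, w)) ps)"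
    by blast
  then show ?thesis
    by (simp add: tensor_def)
qed

private lemma scl: "set (map (\<lambda>(v, w). (c \<odot>\<^bsub>V\<^esub> v, w)) ps) \<subseteq> carrier V \<times> carrier W"
  if "set ps \<subseteq> carrier V \<times> carrier W" 
  using that by (auto intro: cscale)

private lemma tcar: "carrier (tensor V W) = tensor_class V W ` FS"
  by (simp add: tensor_def)
private lemma tzero: "\<zero>\<^bsub>tensor V W\<^esub> = tensor_class V W []"
  by (simp add: tensor_def)

private lemma dist_eq: "set ps \<subseteq> carrier V \<times> carrier W \<Longrightarrow>
  tensor_eq V W (map (\<lambda>(v, w). ((c+d) \<odot>\<^bsub>V\<^esub> v, w)) ps)
   (map (\<lambda>(v, w). (c \<odot>\<^bsub>V\<^esub> v, w)) ps @ map (\<lambda>(v, w). (d \<odot>\<^bsub>V\<^esub> v, w)) ps)"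
proof (induction ps)
  case Nil show ?case by (simp add: tensor_eq.refl)
next
  case (Cons p ps)
  obtain v w where p: "p = (v,w)" by fastforce
  let ?m = "\<lambda>c. map (\<lambda>(v, w). (c \<odot>\<^bsub>V\<^esub> v, w))"
  have vw: "v \<in> carrier V" "w \<in> carrier W" and ps: "set ps \<subseteq> carrier V \<times> carrier W" using Cons p by auto
  have "(c+d) \<odot>\<^bsub>V\<^esub> v = c \<odot>\<^bsub>V\<^esub> v \<oplus>\<^bsub>V\<^esub> d \<odot>\<^bsub>V\<^esub> v"
    using V.smult_l_distr[of c d v] vw by (simp add: cplx_def)
  then have 1: "tensor_eq V W [((c+d) \<odot>\<^bsub>V\<^esub> v, w)] [(c \<odot>\<^bsub>V\<^esub> v, w), (d \<odot>\<^bsub>V\<^esub> v, w)]"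
    using vw by (simp add: tensor_eq.add_left cscale)
  have sd: "set [(d \<odot>\<^bsub>V\<^esub> v, w)] \<subseteq> carrier V \<times> carrier W" and sc: "set [(c \<odot>\<^bsub>V\<^esub> v, w)] \<subseteq> carrier V \<times> carrier W"
    using vw by (simp_all add: cscale)
  have 2: "tensor_eq V W ([((c+d) \<odot>\<^bsub>V\<^esub> v, w)] @ ?m (c+d) ps) ([(c \<odot>\<^bsub>V\<^esub> v, w), (d \<odot>\<^bsub>V\<^esub> v, w)] @ (?m c ps @ ?m d ps))"
    by (rule tensor_eq.append[OF 1 Cons.IH[OF ps]])
  have 3: "tensor_eq V W ([(c \<odot>\<^bsub>V\<^esub> v, w)] @ (([(d \<odot>\<^bsub>V\<^esub> v, w)] @ ?m c ps) @ ?m d ps))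
     ([(c \<odot>\<^bsub>V\<^esub> v, w)] @ ((?m c ps @ [(d \<odot>\<^bsub>V\<^esub> v, w)]) @ ?m d ps))"
    by (rule tensor_eq.append[OF tensor_eq.refl[OF sc] tensor_eq.append[OF tensor_eq.comm[OF sd scl[OF ps]] tensor_eq.refl[OF scl[OF ps]]]])
  have "tensor_eq V W ([((c+d) \<odot>\<^bsub>V\<^esub> v, w)] @ ?m (c+d) ps)
     ([(c \<odot>\<^bsub>V\<^esub> v, w)] @ ((?m c ps @ [(d \<odot>\<^bsub>V\<^esub> v, w)]) @ ?m d ps))"
    by (rule tensor_eq.trans[OF 2]) (use 3 in simp)
  then show ?case by (simp add: p)
qed

lemma module_tensor: "Module.module cplx (tensor V W)"
proof -
  have zero_eq: "tensor_eq V W (map (\<lambda>(v, w). (0 \<odot>\<^bsub>V\<^esub> v, w)) ps) []" if "set ps \<subseteq> carrier V \<times> carrier W" for ps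
    using that
  proof (induction ps)
    case Nil show ?case by (simp add: tensor_eq.refl)
  next
    case (Cons p ps)
    obtain v w where p: "p = (v,w)" by fastforce
    have "0 \<odot>\<^bsub>V\<^esub> v = \<zero>\<^bsub>V\<^esub>" using V.smult_l_null[of v] Cons p by (simp add: cplx_def)
    then have "tensor_eq V W [(0 \<odot>\<^bsub>V\<^esub> v, w)] []" using Cons p by (simp add: tensor_eq.zero)
    from tensor_eq.append[OF this Cons.IH] show ?case using Cons p by simp
  qed
  have one_eq: "map (\<lambda>(v, w). (1 \<odot>\<^bsub>V\<^esub> v, w)) ps = ps" if "set ps \<subseteq> carrier V \<times> carrier W" for ps
  proof (rule map_idI)
    fix p assume "p \<in> set ps"
    then show "(case p of (v, w) \<Rightarrow> (1 \<odot>\<^bsub>V\<^esub> v, w)) = p" using that V.smult_one by (auto simp: cplx_def)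
  qed
  show ?thesis
  proof (rule moduleI)
    show "cring cplx" by (rule V.R.is_cring)
    show "abelian_group (tensor V W)"
    proof (rule abelian_groupI)
      fix x assume "x \<in> carrier (tensor V W)"
      then obtain ps where ps: "x = tensor_class V W ps" "set ps \<subseteq> carrier V \<times> carrier W" by (auto simp: tcar)
      let ?y = "tensor_class V W (map (\<lambda>(v, w). ((-1) \<odot>\<^bsub>V\<^esub> v, w)) ps)"
      have "?y \<in> carrier (tensor V W)" using scl[OF ps(2)] by (auto simp: tcar)
      moreover have "?y \<oplus>\<^bsub>tensor V W\<^esub> x = \<zero>\<^bsub>tensor V W\<^esub>"
        unfolding ps(1) tensor_add_class[OF scl[OF ps(2)] ps(2)] tzero
        by (rule ceq[OF tensor_eq.trans[OF tensor_eq.sym zero_eq[OF ps(2)]]])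
          (use dist_eq[OF ps(2), of "-1" 1] one_eq[OF ps(2)] in \<open>simp only: add.left_inverse\<close>)
      ultimately show "\<exists>y\<in>carrier (tensor V W). y \<oplus>\<^bsub>tensor V W\<^esub> x = \<zero>\<^bsub>tensor V W\<^esub>" by blast
    next
      show "\<zero>\<^bsub>tensor V W\<^esub> \<in> carrier (tensor V W)" by (simp add: tcar tzero)
    next
      fix x y assume "x \<in> carrier (tensor V W)" "y \<in> carrier (tensor V W)"
      then obtain ps qs where ps: "x = tensor_class V W ps" "set ps \<subseteq> carrier V \<times> carrier W"
        and qs: "y = tensor_class V W qs" "set qs \<subseteq> carrier V \<times> carrier W" by (auto simp: tcar)
      have pq: "set (ps @ qs) \<subseteq> carrier V \<times> carrier W" using ps qs by simp
      show "x \<oplus>\<^bsub>tensor V W\<^esub> y \<in> carrier (tensor V W)"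
        unfolding ps(1) qs(1) tensor_add_class[OF ps(2) qs(2)] tcar by (intro imageI CollectI pq)
      show "x \<oplus>\<^bsub>tensor V W\<^esub> y = y \<oplus>\<^bsub>tensor V W\<^esub> x"
        unfolding ps(1) qs(1) tensor_add_class[OF ps(2) qs(2)] tensor_add_class[OF qs(2) ps(2)]
        by (rule ceq[OF tensor_eq.comm[OF ps(2) qs(2)]])
      fix z assume "z \<in> carrier (tensor V W)"
      then obtain rs where rs: "z = tensor_class V W rs" "set rs \<subseteq> carrier V \<times> carrier W" by (auto simp: tcar)
      have qr: "set (qs @ rs) \<subseteq> carrier V \<times> carrier W" using rs qs by simp
      show "x \<oplus>\<^bsub>tensor V W\<^esub> y \<oplus>\<^bsub>tensor V W\<^esub> z = x \<oplus>\<^bsub>tensor V W\<^esub> (y \<oplus>\<^bsub>tensor V W\<^esub> z)"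
        unfolding ps(1) qs(1) rs(1) tensor_add_class[OF ps(2) qs(2)] tensor_add_class[OF qs(2) rs(2)]
          tensor_add_class[OF pq rs(2)] tensor_add_class[OF ps(2) qr] by simp
    next
      fix x assume "x \<in> carrier (tensor V W)"
      then obtain ps where ps: "x = tensor_class V W ps" "set ps \<subseteq> carrier V \<times> carrier W" by (auto simp: tcar)
      show "\<zero>\<^bsub>tensor V W\<^esub> \<oplus>\<^bsub>tensor V W\<^esub> x = x"
        unfolding ps(1) tzero using tensor_add_class[of "[]" ps] ps(2) by simp
    qed
  next
    fix a x assume "x \<in> carrier (tensor V W)"
    then obtain ps where ps: "x = tensor_class V W ps" "set ps \<subseteq> carrier V \<times> carrier W" by (auto simp: tcar)
    show "a \<odot>\<^bsub>tensor V W\<^esub> x \<in> carrier (tensor V W)"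
      unfolding ps(1) tensor_smult_class[OF ps(2)] using scl[OF ps(2)] by (auto simp: tcar)
    show "\<one>\<^bsub>cplx\<^esub> \<odot>\<^bsub>tensor V W\<^esub> x = x"
      unfolding ps(1) tensor_smult_class[OF ps(2)] using one_eq[OF ps(2)] by (simp add: cplx_def)
    fix b
    show "(a \<oplus>\<^bsub>cplx\<^esub> b) \<odot>\<^bsub>tensor V W\<^esub> x = a \<odot>\<^bsub>tensor V W\<^esub> x \<oplus>\<^bsub>tensor V W\<^esub> b \<odot>\<^bsub>tensor V W\<^esub> x"
      unfolding ps(1) tensor_smult_class[OF ps(2)] tensor_add_class[OF scl[OF ps(2)] scl[OF ps(2)]]
      using ceq[OF dist_eq[OF ps(2)]] by (simp add: cplx_def)
    have "(a * b) \<odot>\<^bsub>V\<^esub> v = a \<odot>\<^bsub>V\<^esub> (b \<odot>\<^bsub>V\<^esub> v)" if "v \<in> carrier V" for v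
      using V.smult_assoc1[of a b v] that by (simp add: cplx_def)
    then have *: "map (\<lambda>(v, w). ((a * b) \<odot>\<^bsub>V\<^esub> v, w)) ps = map (\<lambda>(v, w). (a \<odot>\<^bsub>V\<^esub> v, w)) (map (\<lambda>(v, w). (b \<odot>\<^bsub>V\<^esub> v, w)) ps)"
      using ps(2) by auto
    have ab: "a \<otimes>\<^bsub>cplx\<^esub> b = a * b" by (simp add: cplx_def)
    show "(a \<otimes>\<^bsub>cplx\<^esub> b) \<odot>\<^bsub>tensor V W\<^esub> x = a \<odot>\<^bsub>tensor V W\<^esub> (b \<odot>\<^bsub>tensor V W\<^esub> x)"
      unfolding ps(1) tensor_smult_class[OF ps(2)] tensor_smult_class[OF scl[OF ps(2)]] ab * ..
    fix y assume "y \<in> carrier (tensor V W)"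
    then obtain qs where qs: "y = tensor_class V W qs" "set qs \<subseteq> carrier V \<times> carrier W" by (auto simp: tcar)
    have pq: "set (ps @ qs) \<subseteq> carrier V \<times> carrier W" using ps qs by auto
    show "a \<odot>\<^bsub>tensor V W\<^esub> (x \<oplus>\<^bsub>tensor V W\<^esub> y) = a \<odot>\<^bsub>tensor V W\<^esub> x \<oplus>\<^bsub>tensor V W\<^esub> a \<odot>\<^bsub>tensor V W\<^esub> y"
      unfolding ps(1) qs(1) tensor_add_class[OF ps(2) qs(2)] tensor_smult_class[OF ps(2)] tensor_smult_class[OF qs(2)] 
        tensor_add_class[OF scl[OF ps(2)] scl[OF qs(2)]] tensor_smult_class[OF pq] by simp
  qed
qed
end

text \<open>For a tensor \<open>t = \<Sum>\<^sub>i v\<^sub>i \<otimes> w\<^sub>i\<close>, the element \<open>\<Sum>\<^sub>i B v\<^sub>i w\<^sub>i\<close> of \<open>X\<close>.  With \<open>t = \<Delta> a\<close> this is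
  the Sweedler notation for \<open>B a\<^sub>(\<^sub>1\<^sub>) a\<^sub>(\<^sub>2\<^sub>)\<close>.  It is used only for biadditive balanced \<open>B\<close>, for which it does not
  depend on the chosen representative (see \<open>sweedler_eq\<close> below); \<open>B\<close> may be antilinear in both arguments.\<close>

definition list_total :: "('b, 'y) ring_scheme \<Rightarrow> ('v \<Rightarrow> 'w \<Rightarrow> 'b) \<Rightarrow> ('v \<times> 'w) list \<Rightarrow> 'b"
  where "list_total X B ps = foldr (\<lambda>(v, w) s. B v w \<oplus>\<^bsub>X\<^esub> s) ps \<zero>\<^bsub>X\<^esub>"

definition sweedler :: "('b, 'y) ring_scheme \<Rightarrow> ('v \<Rightarrow> 'w \<Rightarrow> 'b) \<Rightarrow> ('v \<times> 'w) list set \<Rightarrow> 'b"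
  where "sweedler X B t = list_total X B (SOME ps. ps \<in> t)"

lemma tensor_eq_carrier:
  assumes "Module.module cplx V" "Module.module cplx W" "tensor_eq V W ps qs"
  shows "set ps \<subseteq> carrier V \<times> carrier W \<and> set qs \<subseteq> carrier V \<times> carrier W"
proof -
  interpret V: Module.module cplx V by fact
  interpret W: Module.module cplx W by fact
  show ?thesis
    using assms(3) 
  proof induction
    case (balanced v w c)
    have "c \<in> carrier cplx" by (simp add: cplx_def)
    then show ?case
      using balanced by auto
  qed auto
qed

lemma list_total_closed:
  assumes "abelian_group X"
    and "\<And>v w. v \<in> carrier V \<Longrightarrow> w \<in> carrier W \<Longrightarrow> B v w \<in> carrier X"
    and "set ps \<subseteq> carrier V \<times> carrier W"
  shows "list_total X B ps \<in> carrier X"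
proof -
  interpret X: abelian_group X by fact
  show ?thesis
    using assms(3) by (induction ps) (auto simp: list_total_def assms(2))
qed

lemma list_total_append:
  assumes "abelian_group X"
    and "\<And>v w. v \<in> carrier V \<Longrightarrow> w \<in> carrier W \<Longrightarrow> B v w \<in> carrier X"
    and "set ps \<subseteq> carrier V \<times> carrier W" "set qs \<subseteq> carrier V \<times> carrier W"
  shows "list_total X B (ps @ qs) = list_total X B ps \<oplus>\<^bsub>X\<^esub> list_total X B qs"
proof -
  interpret X: abelian_group X by fact
  have q: "list_total X B qs \<in> carrier X"
    by (rule list_total_closed[OF assms(1,2,4)])
  show ?thesis
    using assms(3)
  proof (induction ps)
    case Nil
    then show ?case using q by (simp add: list_total_def)
  next
    case (Cons p ps)
    then have "list_total X B ps \<in> carrier X"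
      by (intro list_total_closed[OF assms(1,2)]) auto
    then show ?case
      using Cons q by (cases p) (auto simp: list_total_def assms(2) X.a_assoc)
  qed
qed

lemma sweedler_eq:
  assumes "Module.module cplx V" "Module.module cplx W" "abelian_group X"
    and closed: "\<And>v w. v \<in> carrier V \<Longrightarrow> w \<in> carrier W \<Longrightarrow> B v w \<in> carrier X"
    and left: "\<And>v v' w. v \<in> carrier V \<Longrightarrow> v' \<in> carrier V \<Longrightarrow> w \<in> carrier W \<Longrightarrow>
      B (v \<oplus>\<^bsub>V\<^esub> v') w = B v w \<oplus>\<^bsub>X\<^esub> B v' w"
    and right: "\<And>v w w'. v \<in> carrier V \<Longrightarrow> w \<in> carrier W \<Longrightarrow> w' \<in> carrier W \<Longrightarrow>
      B v (w \<oplus>\<^bsub>W\<^esub> w') = B v w \<oplus>\<^bsub>X\<^esub> B v w'"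
    and balanced: "\<And>c v w. v \<in> carrier V \<Longrightarrow> w \<in> carrier W \<Longrightarrow>
      B (c \<odot>\<^bsub>V\<^esub> v) w = B v (c \<odot>\<^bsub>W\<^esub> w)"
    and ps: "set ps \<subseteq> carrier V \<times> carrier W"
  shows "sweedler X B (tensor_class V W ps) = list_total X B ps"
proof -
  interpret V: Module.module cplx V by fact
  interpret W: Module.module cplx W by fact
  interpret X: abelian_group X by fact
  have cl: "list_total X B qs \<in> carrier X" if "set qs \<subseteq> carrier V \<times> carrier W" for qs
    by (rule list_total_closed[OF assms(3) _ that]) (rule closed)
  have app: "list_total X B (qs @ rs) = list_total X B qs \<oplus>\<^bsub>X\<^esub> list_total X B rs"
    if "set qs \<subseteq> carrier V \<times> carrier W" "set rs \<subseteq> carrier V \<times> carrier W" for qs rs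
    by (rule list_total_append[OF assms(3) _ that]) (rule closed)
  have null: "B \<zero>\<^bsub>V\<^esub> w = \<zero>\<^bsub>X\<^esub>" if w: "w \<in> carrier W" for w
  proof -
    have B0: "B \<zero>\<^bsub>V\<^esub> w \<in> carrier X"
      by (rule closed[OF V.zero_closed w])
    have "B \<zero>\<^bsub>V\<^esub> w \<oplus>\<^bsub>X\<^esub> B \<zero>\<^bsub>V\<^esub> w = B (\<zero>\<^bsub>V\<^esub> \<oplus>\<^bsub>V\<^esub> \<zero>\<^bsub>V\<^esub>) w"
      by (rule left[OF V.zero_closed V.zero_closed w, symmetric])
    also have "\<dots> = B \<zero>\<^bsub>V\<^esub> w"
      by (simp only: V.l_zero[OF V.zero_closed])
    finally show ?thesis
      using X.add.l_cancel_one[OF B0 B0] by (simp only: simp_thms)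
  qed
  have total_eq: "list_total X B ps = list_total X B qs" if "tensor_eq V W ps qs" for ps qs
    using that
  proof induction
    case (refl ps)
    show ?case by (rule HOL.refl)
  next
    case (sym ps qs)
    show ?case by (rule sym.IH[symmetric])
  next
    case (trans ps qs rs)
    show ?case by (rule trans.IH(1)[THEN HOL.trans, OF trans.IH(2)])
  next
    case (append ps ps' qs qs')
    have c: "set ps \<subseteq> carrier V \<times> carrier W" "set ps' \<subseteq> carrier V \<times> carrier W"
        "set qs \<subseteq> carrier V \<times> carrier W" "set qs' \<subseteq> carrier V \<times> carrier W"
      using tensor_eq_carrier[OF assms(1,2)] append.hyps by blast+
    show ?case
      by (simp only: app[OF c(1,3)] app[OF c(2,4)] append.IH)
  next
    case (comm ps qs)
    show ?case
      by (simp only: app[OF comm] app[OF comm(2,1)] X.a_comm[OF cl[OF comm(1)] cl[OF comm(2)]])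
  next
    case (add_left v v' w)
    show ?case
      using closed[OF add_left(1,3)] closed[OF add_left(2,3)]
      by (simp add: list_total_def left[OF add_left] X.a_assoc)
  next
    case (add_right v w w')
    show ?case
      using closed[OF add_right(1,2)] closed[OF add_right(1,3)]
      by (simp add: list_total_def right[OF add_right] X.a_assoc)
  next
    case (zero w)
    show ?case
      by (simp add: list_total_def null[OF zero])
  next
    case (balanced v w c)
    show ?case
      by (simp add: list_total_def assms(7)[OF balanced])
  qed
  have "(SOME qs. qs \<in> tensor_class V W ps) \<in> tensor_class V W ps"
    by (rule someI[of _ ps]) (simp add: tensor_class_def tensor_eq.refl[OF ps])
  then show ?thesis
    unfolding sweedler_def tensor_class_def by (metis mem_Collect_eq total_eq)
qed


section \<open>Hopf $*$-algebras\<close>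

record 'h hopf_star = "(complex, 'h) module" +
  coprod :: "'h \<Rightarrow> ('h \<times> 'h) list set"
  counit :: "'h \<Rightarrow> complex"
  antipode :: "'h \<Rightarrow> 'h"
  star :: "'h \<Rightarrow> 'h"

locale complex_algebra = ring H + Module.module cplx H
  for H :: "(complex, 'h, 'z) module_scheme" (structure) +
  assumes smult_mult_left: "x \<in> carrier H \<Longrightarrow> y \<in> carrier H \<Longrightarrow>
      (c \<odot> x) \<otimes> y = c \<odot> (x \<otimes> y)"
    and smult_mult_right: "x \<in> carrier H \<Longrightarrow> y \<in> carrier H \<Longrightarrow>
      x \<otimes> (c \<odot> y) = c \<odot> (x \<otimes> y)"

locale complex_bialgebra = complex_algebra H
  for H :: "('h, 'z) hopf_star_scheme" (structure) +
  assumes coprod_linear: "linear_on H (tensor H H) (coprod H)"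
    and counit_linear: "linear_on H cplx (counit H)"
    and coassoc: "a \<in> carrier H \<Longrightarrow>
      sweedler (tensor H (tensor H H))
        (\<lambda>x y. sweedler (tensor H (tensor H H))
          (\<lambda>x1 x2. pure_tensor H (tensor H H) x1 (pure_tensor H H x2 y)) (coprod H x))
        (coprod H a) =
      sweedler (tensor H (tensor H H))
        (\<lambda>x y. sweedler (tensor H (tensor H H))
          (\<lambda>y1 y2. pure_tensor H (tensor H H) x (pure_tensor H H y1 y2)) (coprod H y))
        (coprod H a)"
    and counit_left: "a \<in> carrier H \<Longrightarrow> sweedler H (\<lambda>x y. counit H x \<odot> y) (coprod H a) = a"
    and counit_right: "a \<in> carrier H \<Longrightarrow> sweedler H (\<lambda>x y. counit H y \<odot> x) (coprod H a) = a"
    and coprod_mult: "a \<in> carrier H \<Longrightarrow> b \<in> carrier H \<Longrightarrow>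
      coprod H (a \<otimes> b) =
        sweedler (tensor H H)
          (\<lambda>a1 a2. sweedler (tensor H H)
            (\<lambda>b1 b2. pure_tensor H H (a1 \<otimes> b1) (a2 \<otimes> b2)) (coprod H b))
          (coprod H a)"
    and coprod_one: "coprod H \<one> = pure_tensor H H \<one> \<one>"
    and counit_mult: "a \<in> carrier H \<Longrightarrow> b \<in> carrier H \<Longrightarrow>
      counit H (a \<otimes> b) = counit H a * counit H b"
    and counit_one: "counit H \<one> = 1"

locale hopf_algebra = complex_bialgebra H
  for H :: "('h, 'z) hopf_star_scheme" (structure) +
  assumes antipode_linear: "linear_on H H (antipode H)"
    and antipode_left: "a \<in> carrier H \<Longrightarrow>
      sweedler H (\<lambda>x y. antipode H x \<otimes> y) (coprod H a) = counit H a \<odot> \<one>"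
    and antipode_right: "a \<in> carrier H \<Longrightarrow>
      sweedler H (\<lambda>x y. x \<otimes> antipode H y) (coprod H a) = counit H a \<odot> \<one>"

locale hopf_star_algebra = hopf_algebra H
  for H :: "('h, 'z) hopf_star_scheme" (structure) +
  assumes star_antilinear: "antilinear_on H H (star H)"
    and star_star: "a \<in> carrier H \<Longrightarrow> star H (star H a) = a"
    and star_mult: "a \<in> carrier H \<Longrightarrow> b \<in> carrier H \<Longrightarrow>
      star H (a \<otimes> b) = star H b \<otimes> star H a"
    and coprod_star: "a \<in> carrier H \<Longrightarrow>
      coprod H (star H a) =
        sweedler (tensor H H) (\<lambda>x y. pure_tensor H H (star H x) (star H y)) (coprod H a)"


section \<open>Left modules over a Hopf algebra\<close>

record ('h, 'v) hmodule = "(complex, 'v) module" +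
  action :: "'h \<Rightarrow> 'v \<Rightarrow> 'v"

definition left_hmodule :: "('h, 'z) hopf_star_scheme \<Rightarrow> ('h, 'v) hmodule \<Rightarrow> bool"
  where "left_hmodule H V \<longleftrightarrow>
    Module.module cplx V \<and>
    (\<forall>a\<in>carrier H. linear_on V V (action V a)) \<and>
    (\<forall>v\<in>carrier V. linear_on H V (\<lambda>a. action V a v)) \<and>
    (\<forall>a\<in>carrier H. \<forall>b\<in>carrier H. \<forall>v\<in>carrier V.
      action V (a \<otimes>\<^bsub>H\<^esub> b) v = action V a (action V b v)) \<and>
    (\<forall>v\<in>carrier V. action V \<one>\<^bsub>H\<^esub> v = v)"

definition hmod_hom ::
  "('h, 'z) hopf_star_scheme \<Rightarrow> ('h, 'v) hmodule \<Rightarrow> ('h, 'w) hmodule \<Rightarrow> ('v \<Rightarrow> 'w) set"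
  where "hmod_hom H V W = {T \<in> lin_hom V W.
    \<forall>a\<in>carrier H. \<forall>v\<in>carrier V. T (action V a v) = action W a (T v)}"

definition hmod_iso ::
  "('h, 'z) hopf_star_scheme \<Rightarrow> ('h, 'v) hmodule \<Rightarrow> ('h, 'w) hmodule \<Rightarrow> ('v \<Rightarrow> 'w) \<Rightarrow> bool"
  where "hmod_iso H V W T \<longleftrightarrow>
    left_hmodule H V \<and> left_hmodule H W \<and>
    T \<in> hmod_hom H V W \<and> bij_betw T (carrier V) (carrier W)"

definition antimodule_map ::
  "('h, 'z) hopf_star_scheme \<Rightarrow> ('h, 'v) hmodule \<Rightarrow> ('h, 'w) hmodule \<Rightarrow> ('v \<Rightarrow> 'w) \<Rightarrow> bool"
  where "antimodule_map H V W T \<longleftrightarrow>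
    left_hmodule H V \<and> left_hmodule H W \<and> antilinear_on V W T \<and>
    (\<forall>a\<in>carrier H. \<forall>v\<in>carrier V.
      T (action V a v) = action W (star H (antipode H a)) (T v))"


subsection \<open>Complex conjugates\<close>

text \<open>The formal symbols: \<open>Cbar\<close> is the map \<open>c\<^sub>V\<close>, and \<open>uncbar\<close> is its inverse.\<close>

datatype 'v cbar = Cbar (uncbar: 'v)

definition conj_hmod ::
  "('h, 'z) hopf_star_scheme \<Rightarrow> ('h, 'v) hmodule \<Rightarrow> ('h, 'v cbar) hmodule"
  where "conj_hmod H V =
    \<lparr>carrier = Cbar ` carrier V,
     mult = undefined, one = undefined,
     zero = Cbar \<zero>\<^bsub>V\<^esub>,
     add = (\<lambda>x y. Cbar (uncbar x \<oplus>\<^bsub>V\<^esub> uncbar y)),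
     smult = (\<lambda>c x. Cbar (cnj c \<odot>\<^bsub>V\<^esub> uncbar x)),
     action = (\<lambda>a x. Cbar (action V (star H (antipode H a)) (uncbar x)))\<rparr>"

definition conj_map :: "('h, 'v) hmodule \<Rightarrow> ('v \<Rightarrow> 'w) \<Rightarrow> ('v cbar \<Rightarrow> 'w cbar)"
  where "conj_map V T = (\<lambda>x\<in>Cbar ` carrier V. Cbar (T (uncbar x)))"


subsection \<open>Duals\<close>

definition left_dual ::
  "('h, 'z) hopf_star_scheme \<Rightarrow> ('h, 'v) hmodule \<Rightarrow> ('h, 'v \<Rightarrow> complex) hmodule"
  where "left_dual H V =
    \<lparr>carrier = lin_hom V cplx,
     mult = undefined, one = undefined,
     zero = (\<lambda>v\<in>carrier V. 0),
     add = (\<lambda>f g. \<lambda>v\<in>carrier V. f v + g v),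
     smult = (\<lambda>c f. \<lambda>v\<in>carrier V. c * f v),
     action = (\<lambda>a f. \<lambda>v\<in>carrier V. f (action V (antipode H a) v))\<rparr>"

definition right_dual ::
  "('h, 'z) hopf_star_scheme \<Rightarrow> ('h, 'v) hmodule \<Rightarrow> ('h, 'v \<Rightarrow> complex) hmodule"
  where "right_dual H V =
    \<lparr>carrier = lin_hom V cplx,
     mult = undefined, one = undefined,
     zero = (\<lambda>v\<in>carrier V. 0),
     add = (\<lambda>f g. \<lambda>v\<in>carrier V. f v + g v),
     smult = (\<lambda>c f. \<lambda>v\<in>carrier V. c * f v),
     action = (\<lambda>a f. \<lambda>v\<in>carrier V. f (action V (inv_into (carrier H) (antipode H) a) v))\<rparr>"

definition transpose_map ::
  "('h, 'v) hmodule \<Rightarrow> ('h, 'w) hmodule \<Rightarrow> ('v \<Rightarrow> 'w) \<Rightarrow> (('w \<Rightarrow> complex) \<Rightarrow> ('v \<Rightarrow> complex))"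
  where "transpose_map V W T = (\<lambda>f\<in>lin_hom W cplx. compose (carrier V) f T)"


subsection \<open>The comparison maps\<close>

definition b_map :: "('h, 'v) hmodule \<Rightarrow> (('v \<Rightarrow> complex) \<Rightarrow> ('v cbar \<Rightarrow> complex))"
  where "b_map V = (\<lambda>f\<in>lin_hom V cplx. \<lambda>x\<in>Cbar ` carrier V. cnj (f (uncbar x)))"

definition beta_map :: "('h, 'v) hmodule \<Rightarrow> (('v \<Rightarrow> complex) cbar \<Rightarrow> ('v cbar \<Rightarrow> complex))"
  where "beta_map V = compose (Cbar ` lin_hom V cplx) (b_map V) uncbar"


section \<open>Functors on the category of left modules\<close>

text \<open>HOL has no type containing all left modules together with their duals, so the category of left
  modules is stratified by types: for each type \<open>'u\<close> there is the full subcategory of the modules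
  whose carrier is a set of elements of \<open>'u\<close>.  A functor given by a construction changing the type
  of elements is defined on the subcategory for an arbitrary \<open>'u\<close>, with values in the
  subcategory for another type; it consists of an object map and of an arrow map, the latter taking the
  source and the target of an arrow as further arguments.\<close>

definition contravariant_functor ::
  "('h, 'z) hopf_star_scheme \<Rightarrow> (('h, 'u) hmodule \<Rightarrow> ('h, 'a) hmodule)
    \<Rightarrow> (('h, 'u) hmodule \<Rightarrow> ('h, 'u) hmodule \<Rightarrow> ('u \<Rightarrow> 'u) \<Rightarrow> ('a \<Rightarrow> 'a)) \<Rightarrow> bool"
  where "contravariant_functor H F Fm \<longleftrightarrow>
    (\<forall>V. left_hmodule H V \<longrightarrow> left_hmodule H (F V)) \<and>
    (\<forall>V W T. left_hmodule H V \<longrightarrow> left_hmodule H W \<longrightarrow> T \<in> hmod_hom H V W \<longrightarrow>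
      Fm V W T \<in> hmod_hom H (F W) (F V)) \<and>
    (\<forall>V. left_hmodule H V \<longrightarrow>
      Fm V V (\<lambda>v\<in>carrier V. v) = (\<lambda>x\<in>carrier (F V). x)) \<and>
    (\<forall>U V W S T. left_hmodule H U \<longrightarrow> left_hmodule H V \<longrightarrow> left_hmodule H W \<longrightarrow>
      S \<in> hmod_hom H U V \<longrightarrow> T \<in> hmod_hom H V W \<longrightarrow>
      Fm U W (compose (carrier U) T S) = compose (carrier (F W)) (Fm U V S) (Fm V W T))"

definition natural_equivalence ::
  "('h, 'z) hopf_star_scheme
    \<Rightarrow> (('h, 'u) hmodule \<Rightarrow> ('h, 'a) hmodule)
    \<Rightarrow> (('h, 'u) hmodule \<Rightarrow> ('h, 'u) hmodule \<Rightarrow> ('u \<Rightarrow> 'u) \<Rightarrow> ('a \<Rightarrow> 'a))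
    \<Rightarrow> (('h, 'u) hmodule \<Rightarrow> ('h, 'b) hmodule)
    \<Rightarrow> (('h, 'u) hmodule \<Rightarrow> ('h, 'u) hmodule \<Rightarrow> ('u \<Rightarrow> 'u) \<Rightarrow> ('b \<Rightarrow> 'b))
    \<Rightarrow> (('h, 'u) hmodule \<Rightarrow> ('a \<Rightarrow> 'b)) \<Rightarrow> bool"
  where "natural_equivalence H F Fm G Gm \<eta> \<longleftrightarrow>
    contravariant_functor H F Fm \<and> contravariant_functor H G Gm \<and>
    (\<forall>V. left_hmodule H V \<longrightarrow> hmod_iso H (F V) (G V) (\<eta> V)) \<and>
    (\<forall>V W T. left_hmodule H V \<longrightarrow> left_hmodule H W \<longrightarrow> T \<in> hmod_hom H V W \<longrightarrow>
      compose (carrier (F W)) (\<eta> V) (Fm V W T) = compose (carrier (F W)) (Gm V W T) (\<eta> W))"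

end

theory Submission
  imports Defs
begin

text \<open>
  The proposition rests on three identities of a Hopf $*$-algebra: \<open>S 1 = 1\<close>, \<open>S (a b) = S b S a\<close>
  (\<open>antipode_mult\<close>) and \<open>S (S (a\<^sup>*)\<^sup>*) = a\<close> (\<open>antipode_conj_right_inverse\<close>), whose conjugate is
  \<open>(S ((S a)\<^sup>*))\<^sup>* = a\<close> (\<open>antipode_star_antipode_star\<close>); together these two make \<open>S\<close> bijective.

  Since \<open>S\<close> and \<open>a \<mapsto> S (a\<^sup>*)\<^sup>*\<close> are unital and reverse products, the duals and the conjugate of a
  module are modules.  An element \<open>c\<close> acts on the functional \<open>b_map f\<close> through the action of \<open>S\<inverse> c\<close> on the
  conjugate module, which is the action of \<open>(S (S\<inverse> c))\<^sup>* = c\<^sup>*\<close> on the module itself.  For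
  \<open>c = (S a)\<^sup>*\<close> this is the action of \<open>S a\<close>, through which \<open>a\<close> acts on \<open>f\<close> in the left dual.  So
  \<open>b_map\<close> is an antimodule map.  On the conjugate of the left dual, \<open>a\<close> acts as \<open>(S a)\<^sup>*\<close>, and the
  identity \<open>(S ((S a)\<^sup>*))\<^sup>* = a\<close> turns the antimodule property of \<open>b_map\<close> into linearity of \<open>beta_map\<close>
  over the Hopf algebra.  Naturality says that conjugating the values of a functional commutes
  with composing it with a module map.

  The identities for \<open>S\<close> express uniqueness of convolution inverses, written out with Sweedler sums.
  For multiplicativity, the sum of all
  \<open>S (a\<^sub>1 b\<^sub>1) (a\<^sub>2 b\<^sub>2) (S b\<^sub>3 S a\<^sub>3)\<close> collapses from the right to \<open>S (a b)\<close> and from the left to \<open>S b S a\<close>.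
  For the last identity, write \<open>T a = S (a\<^sup>*)\<^sup>*\<close>.  The conjugate of the antipode axiom at \<open>a\<^sup>*\<close> evaluates
  \<open>a\<^sub>2 T a\<^sub>1\<close>; applying \<open>S\<close> shows that \<open>S \<circ> T\<close> is a left convolution inverse of \<open>S\<close>, and the identity map
  is a right one.  Such computations use coassociativity inside arbitrary trilinear forms
  (\<open>sw_coassoc\<close>), which holds because a multilinear form factors through the tensor product
  (\<open>sweedler_linear\<close>).
\<close>

section \<open>Linear and antilinear maps\<close>

lemma cplx_simps [simp]:
  "carrier cplx = UNIV" "x \<otimes>\<^bsub>cplx\<^esub> y = x * y" "\<one>\<^bsub>cplx\<^esub> = 1" "\<zero>\<^bsub>cplx\<^esub> = 0"
  "x \<oplus>\<^bsub>cplx\<^esub> y = x + y" "x \<odot>\<^bsub>cplx\<^esub> y = x * y"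
  by (simp_all add: cplx_def)

lemma linear_onI:
  assumes "\<And>v. v \<in> carrier V \<Longrightarrow> f v \<in> carrier W"
    and "\<And>u v. u \<in> carrier V \<Longrightarrow> v \<in> carrier V \<Longrightarrow> f (u \<oplus>\<^bsub>V\<^esub> v) = f u \<oplus>\<^bsub>W\<^esub> f v"
    and "\<And>c v. v \<in> carrier V \<Longrightarrow> f (c \<odot>\<^bsub>V\<^esub> v) = c \<odot>\<^bsub>W\<^esub> f v"
  shows "linear_on V W f"
  using assms by (auto simp: linear_on_def)

lemma linear_onD:
  assumes "linear_on V W f"
  shows "v \<in> carrier V \<Longrightarrow> f v \<in> carrier W"
    and "u \<in> carrier V \<Longrightarrow> v \<in> carrier V \<Longrightarrow> f (u \<oplus>\<^bsub>V\<^esub> v) = f u \<oplus>\<^bsub>W\<^esub> f v"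
    and "v \<in> carrier V \<Longrightarrow> f (c \<odot>\<^bsub>V\<^esub> v) = c \<odot>\<^bsub>W\<^esub> f v"
  using assms by (auto simp: linear_on_def)

lemma antilinear_onI:
  assumes "\<And>v. v \<in> carrier V \<Longrightarrow> f v \<in> carrier W"
    and "\<And>u v. u \<in> carrier V \<Longrightarrow> v \<in> carrier V \<Longrightarrow> f (u \<oplus>\<^bsub>V\<^esub> v) = f u \<oplus>\<^bsub>W\<^esub> f v"
    and "\<And>c v. v \<in> carrier V \<Longrightarrow> f (c \<odot>\<^bsub>V\<^esub> v) = cnj c \<odot>\<^bsub>W\<^esub> f v"
  shows "antilinear_on V W f"
  using assms by (auto simp: antilinear_on_def)

lemma antilinear_onD:
  assumes "antilinear_on V W f"
  shows "v \<in> carrier V \<Longrightarrow> f v \<in> carrier W"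
    and "u \<in> carrier V \<Longrightarrow> v \<in> carrier V \<Longrightarrow> f (u \<oplus>\<^bsub>V\<^esub> v) = f u \<oplus>\<^bsub>W\<^esub> f v"
    and "v \<in> carrier V \<Longrightarrow> f (c \<odot>\<^bsub>V\<^esub> v) = cnj c \<odot>\<^bsub>W\<^esub> f v"
  using assms by (auto simp: antilinear_on_def)

definition additive_on :: "('a, 'x) ring_scheme \<Rightarrow> ('b, 'y) ring_scheme \<Rightarrow> ('a \<Rightarrow> 'b) \<Rightarrow> bool"
  where "additive_on X Y f \<longleftrightarrow>
    f \<in> carrier X \<rightarrow> carrier Y \<and>
    (\<forall>u\<in>carrier X. \<forall>v\<in>carrier X. f (u \<oplus>\<^bsub>X\<^esub> v) = f u \<oplus>\<^bsub>Y\<^esub> f v)"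

lemma linear_imp_additive: "linear_on X Y f \<Longrightarrow> additive_on X Y f"
  by (simp add: linear_on_def additive_on_def)

lemma antilinear_imp_additive: "antilinear_on X Y f \<Longrightarrow> additive_on X Y f"
  by (simp add: antilinear_on_def additive_on_def)

lemma additive_on_zero:
  assumes "abelian_group X" "abelian_group Y" "additive_on X Y f"
  shows "f \<zero>\<^bsub>X\<^esub> = \<zero>\<^bsub>Y\<^esub>"
proof -
  interpret X: abelian_group X by fact
  interpret Y: abelian_group Y by fact
  have c: "f \<zero>\<^bsub>X\<^esub> \<in> carrier Y"
    using assms(3) by (auto simp: additive_on_def)
  have "f (\<zero>\<^bsub>X\<^esub> \<oplus>\<^bsub>X\<^esub> \<zero>\<^bsub>X\<^esub>) = f \<zero>\<^bsub>X\<^esub> \<oplus>\<^bsub>Y\<^esub> f \<zero>\<^bsub>X\<^esub>"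
    using assms(3) X.zero_closed unfolding additive_on_def by blast
  then have "f \<zero>\<^bsub>X\<^esub> \<oplus>\<^bsub>Y\<^esub> f \<zero>\<^bsub>X\<^esub> = f \<zero>\<^bsub>X\<^esub>"
    by simp
  then show ?thesis
    using Y.add.l_cancel_one[OF c c] by simp
qed

definition bilinear_on ::
  "(complex, 'v, 'x) module_scheme \<Rightarrow> (complex, 'w, 'y) module_scheme \<Rightarrow>
   (complex, 'b, 'z) module_scheme \<Rightarrow> ('v \<Rightarrow> 'w \<Rightarrow> 'b) \<Rightarrow> bool"
  where "bilinear_on V W X B \<longleftrightarrow>
    (\<forall>w\<in>carrier W. linear_on V X (\<lambda>v. B v w)) \<and> (\<forall>v\<in>carrier V. linear_on W X (B v))"

lemma bilinear_onI:
  assumes "\<And>w. w \<in> carrier W \<Longrightarrow> linear_on V X (\<lambda>v. B v w)"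
    and "\<And>v. v \<in> carrier V \<Longrightarrow> linear_on W X (B v)"
  shows "bilinear_on V W X B"
  using assms by (simp add: bilinear_on_def)

section \<open>Linear functions of a tensor\<close>

lemma additive_list_total:
  assumes "abelian_group X" "abelian_group Y" "additive_on X Y f"
    and "\<And>v w. v \<in> carrier V \<Longrightarrow> w \<in> carrier W \<Longrightarrow> B v w \<in> carrier X"
    and "set ps \<subseteq> carrier V \<times> carrier W"
  shows "f (list_total X B ps) = list_total Y (\<lambda>v w. f (B v w)) ps"
  using assms(5)
proof (induction ps)
  case Nil
  then show ?case by (simp add: list_total_def additive_on_zero[OF assms(1-3)])
next
  case (Cons p ps)
  obtain v w where p: "p = (v, w)" by fastforce
  have "list_total X B ps \<in> carrier X"
    by (rule list_total_closed[OF assms(1,4)]) (use Cons.prems in auto)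
  moreover have "B v w \<in> carrier X" using Cons.prems assms(4) by (simp add: p)
  ultimately have "f (B v w \<oplus>\<^bsub>X\<^esub> list_total X B ps) = f (B v w) \<oplus>\<^bsub>Y\<^esub> f (list_total X B ps)"
    using assms(3) by (simp add: additive_on_def)
  then show ?case using Cons by (simp add: p list_total_def)
qed

lemma list_total_cong:
  assumes "\<And>v w. v \<in> carrier V \<Longrightarrow> w \<in> carrier W \<Longrightarrow> B v w = B' v w"
    and "set ps \<subseteq> carrier V \<times> carrier W"
  shows "list_total X B ps = list_total X B' ps"
  using assms(2) by (induction ps) (auto simp: list_total_def assms(1))

context
  fixes V :: "(complex, 'v, 'x) module_scheme" and W :: "(complex, 'w, 'y) module_scheme"
  assumes V: "Module.module cplx V" and W: "Module.module cplx W"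
begin

lemma tensor_representative:
  assumes "t \<in> carrier (tensor V W)"
  shows "set (SOME ps. ps \<in> t) \<subseteq> carrier V \<times> carrier W"
proof -
  obtain ps where ps: "t = tensor_class V W ps" "set ps \<subseteq> carrier V \<times> carrier W"
    using assms by (auto simp: tensor_def)
  have "(SOME qs. qs \<in> t) \<in> t"
    by (rule someI[of _ ps]) (simp add: ps tensor_class_def tensor_eq.refl)
  then have "tensor_eq V W ps (SOME qs. qs \<in> t)"
    by (simp add: ps(1) tensor_class_def)
  then show ?thesis
    using tensor_eq_carrier[OF V W] by blast
qed

lemma sweedler_cong:
  assumes "t \<in> carrier (tensor V W)"
    and "\<And>v w. v \<in> carrier V \<Longrightarrow> w \<in> carrier W \<Longrightarrow> B v w = B' v w"
  shows "sweedler X B t = sweedler X B' t"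
  unfolding sweedler_def
  by (rule list_total_cong[OF assms(2) tensor_representative[OF assms(1)]])

lemma sweedler_closed:
  assumes "abelian_group X" "t \<in> carrier (tensor V W)"
    and "\<And>v w. v \<in> carrier V \<Longrightarrow> w \<in> carrier W \<Longrightarrow> B v w \<in> carrier X"
  shows "sweedler X B t \<in> carrier X"
  unfolding sweedler_def
  by (rule list_total_closed[OF assms(1,3) tensor_representative[OF assms(2)]])

text \<open>Both sides are the sum over one and the same representative of \<open>t\<close>, and an additive map passes
  inside a finite sum.\<close>

lemma additive_sweedler:
  assumes "abelian_group X" "abelian_group Y" "additive_on X Y f"
    and "t \<in> carrier (tensor V W)"
    and "\<And>v w. v \<in> carrier V \<Longrightarrow> w \<in> carrier W \<Longrightarrow> B v w \<in> carrier X"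
  shows "f (sweedler X B t) = sweedler Y (\<lambda>v w. f (B v w)) t"
  unfolding sweedler_def
  by (rule additive_list_total[OF assms(1-3,5) tensor_representative[OF assms(4)]])

lemma pure_tensor_closed:
  "v \<in> carrier V \<Longrightarrow> w \<in> carrier W \<Longrightarrow> pure_tensor V W v w \<in> carrier (tensor V W)"
  by (auto simp: pure_tensor_def tensor_def)

context
  fixes X :: "(complex, 'b, 'z) module_scheme" and B :: "'v \<Rightarrow> 'w \<Rightarrow> 'b"
  assumes X: "Module.module cplx X" and B: "bilinear_on V W X B"
begin

interpretation X: Module.module cplx X by (rule X)

lemma bilinear_on_closed: "v \<in> carrier V \<Longrightarrow> w \<in> carrier W \<Longrightarrow> B v w \<in> carrier X"
  using B by (auto simp: bilinear_on_def linear_on_def)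

lemma sweedler_class:
  assumes "set ps \<subseteq> carrier V \<times> carrier W"
  shows "sweedler X B (tensor_class V W ps) = list_total X B ps"
proof (rule sweedler_eq[OF V W X.abelian_group_axioms bilinear_on_closed _ _ _ assms])
qed (use B in \<open>auto simp: bilinear_on_def linear_on_def\<close>)

lemma sweedler_pure_tensor:
  assumes "v \<in> carrier V" "w \<in> carrier W"
  shows "sweedler X B (pure_tensor V W v w) = B v w"
proof -
  have "sweedler X B (pure_tensor V W v w) = list_total X B [(v, w)]"
    unfolding pure_tensor_def by (rule sweedler_class) (use assms in simp)
  then show ?thesis
    using bilinear_on_closed[OF assms] by (simp add: list_total_def)
qed

text \<open>This is the universal property of the tensor product: a bilinear map induces a linear map.\<close>

lemma sweedler_linear: "linear_on (tensor V W) X (sweedler X B)"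
proof (rule linear_onI)
  interpret V: Module.module cplx V by (rule V)
  fix t assume t: "t \<in> carrier (tensor V W)"
  then show "sweedler X B t \<in> carrier X"
    by (rule sweedler_closed[OF X.abelian_group_axioms _ bilinear_on_closed])
  obtain ps where ps: "t = tensor_class V W ps" "set ps \<subseteq> carrier V \<times> carrier W"
    using t by (auto simp: tensor_def)
  {
    fix u assume "u \<in> carrier (tensor V W)"
    then obtain qs where qs: "u = tensor_class V W qs" "set qs \<subseteq> carrier V \<times> carrier W"
      by (auto simp: tensor_def)
    have "set (ps @ qs) \<subseteq> carrier V \<times> carrier W"
      using ps qs by simp
    then show "sweedler X B (t \<oplus>\<^bsub>tensor V W\<^esub> u) = sweedler X B t \<oplus>\<^bsub>X\<^esub> sweedler X B u"
      unfolding ps(1) qs(1) tensor_add_class[OF V W ps(2) qs(2)]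
      using sweedler_class[OF ps(2)] sweedler_class[OF qs(2)]
      by (simp only: sweedler_class
          list_total_append[OF X.abelian_group_axioms bilinear_on_closed ps(2) qs(2)])
  next
    fix c :: complex
    have "set (map (\<lambda>(v, w). (c \<odot>\<^bsub>V\<^esub> v, w)) ps) \<subseteq> carrier V \<times> carrier W"
      using ps(2) V.smult_closed[of c] by auto
    then have "sweedler X B (c \<odot>\<^bsub>tensor V W\<^esub> t) =
        list_total X B (map (\<lambda>(v, w). (c \<odot>\<^bsub>V\<^esub> v, w)) ps)"
      unfolding ps(1) tensor_smult_class[OF V W ps(2)] by (rule sweedler_class)
    also have "\<dots> = list_total X (\<lambda>v w. c \<odot>\<^bsub>X\<^esub> B v w) ps"
      using ps(2) B
      by (induction ps) (auto simp: list_total_def bilinear_on_def linear_on_def)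
    also have "\<dots> = c \<odot>\<^bsub>X\<^esub> list_total X B ps"
    proof (rule additive_list_total[OF X.abelian_group_axioms X.abelian_group_axioms _
          bilinear_on_closed ps(2), symmetric])
      show "additive_on X X ((\<odot>\<^bsub>X\<^esub>) c)"
        by (simp add: additive_on_def X.smult_r_distr)
    qed
    finally show "sweedler X B (c \<odot>\<^bsub>tensor V W\<^esub> t) = c \<odot>\<^bsub>X\<^esub> sweedler X B t"
      by (simp only: ps(1) sweedler_class[OF ps(2)])
  }
qed

end

lemma sweedler_linear_parameter:
  fixes X :: "(complex, 'b, 'z) module_scheme"
  assumes "Module.module cplx X" and t: "t \<in> carrier (tensor V W)"
    and lin: "\<And>v w. v \<in> carrier V \<Longrightarrow> w \<in> carrier W \<Longrightarrow> linear_on Z X (\<lambda>z. B z v w)"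
  shows "linear_on Z X (\<lambda>z. sweedler X (B z) t)"
proof -
  interpret X: Module.module cplx X by fact
  have "linear_on Z X (\<lambda>z. list_total X (B z) ps)" if "set ps \<subseteq> carrier V \<times> carrier W" for ps
    using that
  proof (induction ps)
    case Nil
    show ?case by (rule linear_onI) (simp_all add: list_total_def X.smult_r_null)
  next
    case (Cons p ps)
    obtain v w where p: "p = (v, w)" by fastforce
    have 1: "linear_on Z X (\<lambda>z. B z v w)" and 2: "linear_on Z X (\<lambda>z. list_total X (B z) ps)"
      using Cons p lin by simp_all
    have eq: "list_total X (B z) (p # ps) = B z v w \<oplus>\<^bsub>X\<^esub> list_total X (B z) ps" for z
      by (simp add: p list_total_def)
    show ?case
      unfolding eq
      by (rule linear_onI)
        (simp_all add: linear_onD[OF 1] linear_onD[OF 2] X.a_ac X.smult_r_distr)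
  qed
  then show ?thesis
    unfolding sweedler_def using tensor_representative[OF t] by blast
qed

end

lemma list_total_add:
  assumes "abelian_group X"
    and "\<And>v w. v \<in> carrier V \<Longrightarrow> w \<in> carrier W \<Longrightarrow> B v w \<in> carrier X"
    and "\<And>v w. v \<in> carrier V \<Longrightarrow> w \<in> carrier W \<Longrightarrow> C v w \<in> carrier X"
    and "set ps \<subseteq> carrier V \<times> carrier W"
  shows "list_total X (\<lambda>v w. B v w \<oplus>\<^bsub>X\<^esub> C v w) ps = list_total X B ps \<oplus>\<^bsub>X\<^esub> list_total X C ps"
proof -
  interpret X: abelian_group X by fact
  show ?thesis
    using assms(4)
  proof (induction ps)
    case Nil
    then show ?case by (simp add: list_total_def)
  next
    case (Cons p ps)
    obtain v w where p: "p = (v, w)" by fastforce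
    have ps: "set ps \<subseteq> carrier V \<times> carrier W"
      using Cons.prems by simp
    have 1: "list_total X B ps \<in> carrier X" and 2: "list_total X C ps \<in> carrier X"
      by (rule list_total_closed[OF assms(1,2) ps] list_total_closed[OF assms(1,3) ps]; assumption)+
    have 3: "B v w \<in> carrier X" and 4: "C v w \<in> carrier X"
      using Cons.prems assms(2,3) by (simp_all add: p)
    have step: "list_total X G (p # ps) = G v w \<oplus>\<^bsub>X\<^esub> list_total X G ps" for G
      by (simp add: p list_total_def)
    show ?case
      using Cons 1 2 3 4 by (simp add: step X.a_ac)
  qed
qed

text \<open>Independent Sweedler sums may be interchanged, as finite double sums.\<close>

lemma sweedler_swap:
  assumes V: "Module.module cplx V" and W: "Module.module cplx W"
    and V': "Module.module cplx V'" and W': "Module.module cplx W'"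
    and X: "abelian_group X"
    and t: "t \<in> carrier (tensor V W)" and u: "u \<in> carrier (tensor V' W')"
    and G: "\<And>v w v' w'. v \<in> carrier V \<Longrightarrow> w \<in> carrier W \<Longrightarrow> v' \<in> carrier V' \<Longrightarrow>
      w' \<in> carrier W' \<Longrightarrow> G v w v' w' \<in> carrier X"
  shows "sweedler X (\<lambda>v w. sweedler X (G v w) u) t =
    sweedler X (\<lambda>v' w'. sweedler X (\<lambda>v w. G v w v' w') t) u"
proof -
  interpret X: abelian_group X by fact
  have "list_total X (\<lambda>v w. list_total X (G v w) qs) ps =
      list_total X (\<lambda>v' w'. list_total X (\<lambda>v w. G v w v' w') ps) qs"
    if ps: "set ps \<subseteq> carrier V \<times> carrier W" and qs: "set qs \<subseteq> carrier V' \<times> carrier W'" for ps qs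
    using ps
  proof (induction ps)
    case Nil
    have "list_total X (\<lambda>_ _. \<zero>\<^bsub>X\<^esub>) qs = \<zero>\<^bsub>X\<^esub>"
      by (induction qs) (auto simp: list_total_def)
    then show ?case by (simp add: list_total_def[of _ _ "[]"])
  next
    case (Cons p ps)
    obtain v w where p: "p = (v, w)" by fastforce
    have vw: "v \<in> carrier V" "w \<in> carrier W" and ps: "set ps \<subseteq> carrier V \<times> carrier W"
      using Cons.prems by (simp_all add: p)
    have step: "list_total X F (p # ps) = F v w \<oplus>\<^bsub>X\<^esub> list_total X F ps" for F
      by (simp add: p list_total_def)
    have "list_total X (\<lambda>v' w'. G v w v' w' \<oplus>\<^bsub>X\<^esub> list_total X (\<lambda>v w. G v w v' w') ps) qs =
        list_total X (G v w) qs \<oplus>\<^bsub>X\<^esub> list_total X (\<lambda>v' w'. list_total X (\<lambda>v w. G v w v' w') ps) qs"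
      by (rule list_total_add[OF X _ _ qs])
        (auto intro: G vw intro!: list_total_closed[OF X _ ps])
    then show ?case
      by (simp add: step Cons.IH[OF ps])
  qed
  then show ?thesis
    unfolding sweedler_def
    using tensor_representative[OF V W t] tensor_representative[OF V' W' u] by blast
qed

section \<open>Calculus with the coproduct\<close>

context complex_bialgebra
begin

lemma module_H: "Module.module cplx H"
  by (rule module_axioms)

lemma abelian_group_H: "abelian_group H"
  using module_H by (rule module.axioms(2))

lemma ring_H: "ring H"
  by unfold_locales

lemmas assoc_H = monoid.m_assoc[OF ring.is_monoid[OF ring_H]]
lemmas distr_H = ring.ring_simprules(13,23)[OF ring_H]

abbreviation lin :: "('h \<Rightarrow> 'h) \<Rightarrow> bool"
  where "lin \<equiv> linear_on H H"

abbreviation bilin :: "('h \<Rightarrow> 'h \<Rightarrow> 'h) \<Rightarrow> bool"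
  where "bilin \<equiv> bilinear_on H H H"

abbreviation sw :: "('h \<Rightarrow> 'h \<Rightarrow> 'h) \<Rightarrow> 'h \<Rightarrow> 'h"
  where "sw B a \<equiv> sweedler H B (coprod H a)"

lemma coprod_closed [simp]: "a \<in> carrier H \<Longrightarrow> coprod H a \<in> carrier (tensor H H)"
  by (rule linear_onD(1)[OF coprod_linear])

lemma counit_smult: "a \<in> carrier H \<Longrightarrow> counit H (c \<odot> a) = c * counit H a"
  using linear_onD(3)[OF counit_linear] by simp

lemma smult_closed' [simp]: "a \<in> carrier H \<Longrightarrow> c \<odot> a \<in> carrier H"
  by (rule smult_closed) simp_all

lemma smult_smult: "a \<in> carrier H \<Longrightarrow> c \<odot> (d \<odot> a) = (c * d) \<odot> a"
  using smult_assoc1[of c d a] by simp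

lemma sw_closed:
  assumes "a \<in> carrier H"
    and "\<And>x y. x \<in> carrier H \<Longrightarrow> y \<in> carrier H \<Longrightarrow> B x y \<in> carrier H"
  shows "sw B a \<in> carrier H"
  using sweedler_closed[OF module_H module_H abelian_group_H] assms by simp

lemma sw_cong:
  assumes "a \<in> carrier H"
    and "\<And>x y. x \<in> carrier H \<Longrightarrow> y \<in> carrier H \<Longrightarrow> B x y = B' x y"
  shows "sw B a = sw B' a"
  using assms by (intro sweedler_cong[OF module_H module_H]) simp_all

lemma sw_additive:
  assumes "additive_on H H f" "a \<in> carrier H"
    and "\<And>x y. x \<in> carrier H \<Longrightarrow> y \<in> carrier H \<Longrightarrow> B x y \<in> carrier H"
  shows "f (sw B a) = sw (\<lambda>x y. f (B x y)) a"
  using assms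
  by (intro additive_sweedler[OF module_H module_H abelian_group_H abelian_group_H])
    simp_all

lemmas sw_linear = sw_additive[OF linear_imp_additive]

lemma sw_swap:
  assumes "a \<in> carrier H" "b \<in> carrier H"
    and "\<And>x y u v. x \<in> carrier H \<Longrightarrow> y \<in> carrier H \<Longrightarrow> u \<in> carrier H \<Longrightarrow> v \<in> carrier H \<Longrightarrow>
      G x y u v \<in> carrier H"
  shows "sw (\<lambda>x y. sw (G x y) b) a = sw (\<lambda>u v. sw (\<lambda>x y. G x y u v) a) b"
  using assms
  by (intro sweedler_swap[OF module_H module_H module_H module_H abelian_group_H]) simp_all

text \<open>The following rules show by backward chaining that the expressions below are linear in each
  of their variables.\<close>

named_theorems lin_intros

lemma lin_id [lin_intros]: "lin (\<lambda>x. x)"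
  by (rule linear_onI) simp_all

lemma lin_mult_left [lin_intros]:
  assumes "lin f" "c \<in> carrier H"
  shows "lin (\<lambda>x. f x \<otimes> c)"
  by (rule linear_onI)
    (simp_all add: linear_onD[OF assms(1)] assms(2) distr_H smult_mult_left)

lemma lin_mult_right [lin_intros]:
  assumes "c \<in> carrier H" "lin f"
  shows "lin (\<lambda>x. c \<otimes> f x)"
  by (rule linear_onI)
    (simp_all add: linear_onD[OF assms(2)] assms(1) distr_H smult_mult_right)

lemma lin_smult [lin_intros]:
  assumes "lin f"
  shows "lin (\<lambda>x. c \<odot> f x)"
proof -
  have "c \<odot> (d \<odot> f x) = d \<odot> (c \<odot> f x)" if "x \<in> carrier H" for d x
    using linear_onD(1)[OF assms that] by (simp add: smult_smult mult.commute)
  then show ?thesis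
    by (intro linear_onI) (simp_all add: linear_onD[OF assms] smult_r_distr)
qed

lemma lin_counit [lin_intros]:
  assumes "lin f" "c \<in> carrier H"
  shows "lin (\<lambda>x. counit H (f x) \<odot> c)"
proof -
  have "(s + t) \<odot> c = s \<odot> c \<oplus> t \<odot> c" "(s * t) \<odot> c = s \<odot> (t \<odot> c)" for s t
    using smult_l_distr[of s t c] assms(2) by (simp_all add: smult_smult)
  then show ?thesis
    using linear_onD(2)[OF counit_linear]
    by (intro linear_onI) (simp_all add: linear_onD[OF assms(1)] assms(2) counit_smult)
qed

lemma lin_sw_parameter [lin_intros]:
  assumes "a \<in> carrier H"
    and "\<And>x y. x \<in> carrier H \<Longrightarrow> y \<in> carrier H \<Longrightarrow> lin (\<lambda>z. B z x y)"
  shows "lin (\<lambda>z. sw (B z) a)"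
  using assms by (intro sweedler_linear_parameter[OF module_H module_H module_H]) simp_all

lemma lin_comp:
  assumes "lin f" "lin g"
  shows "lin (\<lambda>x. f (g x))"
  by (rule linear_onI) (simp_all add: linear_onD[OF assms(1)] linear_onD[OF assms(2)])

lemma lin_sw [lin_intros]:
  assumes "lin f" "bilin B"
  shows "lin (\<lambda>z. sw B (f z))"
  using linear_onD[OF sweedler_linear[OF module_H module_H module_H assms(2)]]
    linear_onD[OF coprod_linear] linear_onD[OF assms(1)]
  by (intro linear_onI) simp_all

text \<open>A trilinear form has the same value on the two iterated coproducts, because both are
  the images of one element of the triple tensor product under the linear map it induces.\<close>

lemma sw_coassoc:
  assumes F1: "\<And>y z. y \<in> carrier H \<Longrightarrow> z \<in> carrier H \<Longrightarrow> lin (\<lambda>x. F x y z)"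
    and F2: "\<And>x z. x \<in> carrier H \<Longrightarrow> z \<in> carrier H \<Longrightarrow> lin (\<lambda>y. F x y z)"
    and F3: "\<And>x y. x \<in> carrier H \<Longrightarrow> y \<in> carrier H \<Longrightarrow> lin (\<lambda>z. F x y z)"
    and a: "a \<in> carrier H"
  shows "sw (\<lambda>x y. sw (\<lambda>x1 x2. F x1 x2 y) x) a = sw (\<lambda>x y. sw (\<lambda>y1 y2. F x y1 y2) y) a"
proof -
  let ?T = "tensor H H" and ?T3 = "tensor H (tensor H H)"
  let ?p = "\<lambda>x y z. pure_tensor H ?T x (pure_tensor H H y z)"
  define \<Phi> where "\<Phi> = sweedler H (\<lambda>x u. sweedler H (F x) u)"
  have T: "Module.module cplx ?T"
    by (rule module_tensor[OF module_H module_H])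
  have T3: "Module.module cplx ?T3"
    by (rule module_tensor[OF module_H T])
  have ab: "abelian_group ?T3"
    using T3 by (rule module.axioms(2))
  have FB: "bilin (F x)" if "x \<in> carrier H" for x
    using that F2 F3 by (auto simp: bilinear_on_def)
  have B: "bilinear_on H ?T H (\<lambda>x u. sweedler H (F x) u)"
  proof (rule bilinear_onI)
    fix u assume "u \<in> carrier ?T"
    then show "linear_on H H (\<lambda>x. sweedler H (F x) u)"
      by (rule sweedler_linear_parameter[OF module_H module_H module_H _ F1])
  next
    fix x assume "x \<in> carrier H"
    then show "linear_on ?T H (sweedler H (F x))"
      by (intro sweedler_linear[OF module_H module_H module_H FB])
  qed
  have lin\<Phi>: "additive_on ?T3 H \<Phi>"
    unfolding \<Phi>_def by (rule linear_imp_additive[OF sweedler_linear[OF module_H T module_H B]])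
  have pc: "?p x y z \<in> carrier ?T3"
    if "x \<in> carrier H" "y \<in> carrier H" "z \<in> carrier H" for x y z
    using that by (intro pure_tensor_closed[OF module_H T] pure_tensor_closed[OF module_H module_H])
  have \<Phi>p: "\<Phi> (?p x y z) = F x y z"
    if "x \<in> carrier H" "y \<in> carrier H" "z \<in> carrier H" for x y z
    using that sweedler_pure_tensor[OF module_H T module_H B, of x "pure_tensor H H y z"]
    by (simp add: \<Phi>_def pure_tensor_closed[OF module_H module_H]
        sweedler_pure_tensor[OF module_H module_H module_H FB])
  have pass: "\<Phi> (sweedler ?T3 G (coprod H b)) = sw (\<lambda>x y. \<Phi> (G x y)) b"
    if "b \<in> carrier H" "\<And>x y. x \<in> carrier H \<Longrightarrow> y \<in> carrier H \<Longrightarrow> G x y \<in> carrier ?T3" for b G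
    using that by (intro additive_sweedler[OF module_H module_H ab abelian_group_H lin\<Phi>]) simp_all
  have closed: "sweedler ?T3 G (coprod H b) \<in> carrier ?T3"
    if "b \<in> carrier H" "\<And>x y. x \<in> carrier H \<Longrightarrow> y \<in> carrier H \<Longrightarrow> G x y \<in> carrier ?T3" for b G
    using that by (intro sweedler_closed[OF module_H module_H ab]) simp_all
  have "sw (\<lambda>x y. sw (\<lambda>x1 x2. F x1 x2 y) x) a = sw (\<lambda>x y. sw (\<lambda>x1 x2. \<Phi> (?p x1 x2 y)) x) a"
    by (intro sw_cong a) (simp_all add: \<Phi>p)
  also have "\<dots> = sw (\<lambda>x y. \<Phi> (sweedler ?T3 (\<lambda>x1 x2. ?p x1 x2 y) (coprod H x))) a"
    by (intro sw_cong a pass[symmetric] pc)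
  also have "\<dots> = \<Phi> (sweedler ?T3 (\<lambda>x y. sweedler ?T3 (\<lambda>x1 x2. ?p x1 x2 y) (coprod H x)) (coprod H a))"
    by (intro pass[symmetric] a closed pc)
  also have "\<dots> = \<Phi> (sweedler ?T3 (\<lambda>x y. sweedler ?T3 (\<lambda>y1 y2. ?p x y1 y2) (coprod H y)) (coprod H a))"
    by (simp only: coassoc[OF a])
  also have "\<dots> = sw (\<lambda>x y. \<Phi> (sweedler ?T3 (\<lambda>y1 y2. ?p x y1 y2) (coprod H y))) a"
    by (intro pass a closed pc)
  also have "\<dots> = sw (\<lambda>x y. sw (\<lambda>y1 y2. \<Phi> (?p x y1 y2)) y) a"
    by (intro sw_cong a pass pc)
  also have "\<dots> = sw (\<lambda>x y. sw (\<lambda>y1 y2. F x y1 y2) y) a"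
    by (intro sw_cong a) (simp_all add: \<Phi>p)
  finally show ?thesis .
qed

text \<open>The compatibility of coproduct and product, tested against a bilinear form.\<close>

lemma sw_mult:
  assumes B: "bilin B" and ab: "a \<in> carrier H" "b \<in> carrier H"
  shows "sw B (a \<otimes> b) = sw (\<lambda>a1 a2. sw (\<lambda>b1 b2. B (a1 \<otimes> b1) (a2 \<otimes> b2)) b) a"
proof -
  let ?T = "tensor H H"
  let ?p = "\<lambda>a1 a2 b1 b2. pure_tensor H H (a1 \<otimes> b1) (a2 \<otimes> b2)"
  have T: "abelian_group ?T"
    using module_tensor[OF module_H module_H] by (rule module.axioms(2))
  have pass: "sweedler H B (sweedler ?T G (coprod H x)) = sw (\<lambda>x y. sweedler H B (G x y)) x"
    if "x \<in> carrier H" "\<And>x y. x \<in> carrier H \<Longrightarrow> y \<in> carrier H \<Longrightarrow> G x y \<in> carrier ?T" for x G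
    using that
    by (intro additive_sweedler[OF module_H module_H T abelian_group_H
          linear_imp_additive[OF sweedler_linear[OF module_H module_H module_H B]]]) simp_all
  have closed: "sweedler ?T G (coprod H x) \<in> carrier ?T"
    if "x \<in> carrier H" "\<And>x y. x \<in> carrier H \<Longrightarrow> y \<in> carrier H \<Longrightarrow> G x y \<in> carrier ?T" for x G
    using that by (intro sweedler_closed[OF module_H module_H T]) simp_all
  have pc: "?p a1 a2 b1 b2 \<in> carrier ?T"
    if "a1 \<in> carrier H" "a2 \<in> carrier H" "b1 \<in> carrier H" "b2 \<in> carrier H" for a1 a2 b1 b2
    using that by (simp add: pure_tensor_closed[OF module_H module_H])
  have "sw B (a \<otimes> b) = sw (\<lambda>a1 a2. sweedler H B (sweedler ?T (?p a1 a2) (coprod H b))) a"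
    unfolding coprod_mult[OF ab] using ab by (intro pass closed pc)
  also have "\<dots> = sw (\<lambda>a1 a2. sw (\<lambda>b1 b2. sweedler H B (?p a1 a2 b1 b2)) b) a"
    using ab by (intro sw_cong pass pc)
  also have "\<dots> = sw (\<lambda>a1 a2. sw (\<lambda>b1 b2. B (a1 \<otimes> b1) (a2 \<otimes> b2)) b) a"
    using ab by (intro sw_cong sweedler_pure_tensor[OF module_H module_H module_H B]) simp_all
  finally show ?thesis .
qed

end

section \<open>The antipode\<close>

context hopf_algebra
begin

abbreviation S :: "'h \<Rightarrow> 'h" where "S \<equiv> antipode H"

lemma antipode_closed [simp]: "a \<in> carrier H \<Longrightarrow> S a \<in> carrier H"
  by (rule linear_onD(1)[OF antipode_linear])

lemma lin_antipode [lin_intros]: "lin f \<Longrightarrow> lin (\<lambda>x. S (f x))"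
  by (rule lin_comp[OF antipode_linear])

text \<open>The coproduct of \<open>\<one>\<close> is the single pure tensor \<open>\<one> \<otimes> \<one>\<close>, so the antipode axiom at \<open>\<one>\<close> reads
  \<open>S \<one> \<otimes> \<one> = \<one>\<close>.\<close>

lemma antipode_one: "S \<one> = \<one>"
proof -
  have "bilin (\<lambda>x y. S x \<otimes> y)"
    by (intro bilinear_onI lin_intros) simp_all
  then have "S \<one> \<otimes> \<one> = sw (\<lambda>x y. S x \<otimes> y) \<one>"
    unfolding coprod_one by (intro sweedler_pure_tensor[symmetric, OF module_H module_H module_H]) simp_all
  also have "\<dots> = \<one>"
    using antipode_left[of \<one>] smult_one[of \<one>] by (simp add: counit_one)
  finally show ?thesis by simp
qed

text \<open>Both sides are the sum of one product \<open>G\<close> over the threefold coproducts of \<open>a\<close> and of \<open>b\<close>.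
  Collapsing \<open>a\<^sub>2 b\<^sub>2 S b\<^sub>3 S a\<^sub>3\<close>, by \<open>x\<^sub>1 S x\<^sub>2 = \<epsilon> x\<close> first for \<open>b\<close> and then for \<open>a\<close>, gives
  \<open>S (a b)\<close>.  Collapsing \<open>S (a\<^sub>1 b\<^sub>1) a\<^sub>2 b\<^sub>2\<close>, by \<open>S x\<^sub>1 x\<^sub>2 = \<epsilon> x\<close> for products \<open>x\<close>, gives \<open>S b S a\<close>.
  Two uses of coassociativity, one for \<open>a\<close> and one for \<open>b\<close>, mediate.\<close>

lemma antipode_mult:
  assumes a: "a \<in> carrier H" and b: "b \<in> carrier H"
  shows "S (a \<otimes> b) = S b \<otimes> S a"
proof -
  define G where "G x y z u v w = S (x \<otimes> u) \<otimes> (y \<otimes> v) \<otimes> (S w \<otimes> S z)" for x y z u v w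
  have G [simp]: "G x y z u v w \<in> carrier H"
    if "x \<in> carrier H" "y \<in> carrier H" "z \<in> carrier H" "u \<in> carrier H" "v \<in> carrier H" "w \<in> carrier H"
    for x y z u v w
    using that by (simp add: G_def)
  have collapse_right: "sw (\<lambda>y z. sw (\<lambda>v w. G x y z u v w) q) p =
      (counit H p * counit H q) \<odot> S (x \<otimes> u)"
    if [simp]: "p \<in> carrier H" "q \<in> carrier H" "x \<in> carrier H" "u \<in> carrier H" for p q x u
  proof -
    have inner: "sw (\<lambda>v w. G x y z u v w) q = counit H q \<odot> (S (x \<otimes> u) \<otimes> (y \<otimes> S z))"
      if [simp]: "y \<in> carrier H" "z \<in> carrier H" for y z
    proof -
      have "sw (\<lambda>v w. G x y z u v w) q = sw (\<lambda>v w. S (x \<otimes> u) \<otimes> (y \<otimes> (v \<otimes> S w \<otimes> S z))) q"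
        by (intro sw_cong) (simp_all add: G_def assoc_H)
      also have "\<dots> = S (x \<otimes> u) \<otimes> (y \<otimes> (sw (\<lambda>v w. v \<otimes> S w) q \<otimes> S z))"
        by (rule sw_linear[symmetric]) (intro lin_intros | simp)+
      finally show ?thesis
        by (simp add: antipode_right smult_mult_left smult_mult_right)
    qed
    have "sw (\<lambda>y z. sw (\<lambda>v w. G x y z u v w) q) p =
        sw (\<lambda>y z. counit H q \<odot> (S (x \<otimes> u) \<otimes> (y \<otimes> S z))) p"
      by (intro sw_cong) (simp_all add: inner)
    also have "\<dots> = counit H q \<odot> (S (x \<otimes> u) \<otimes> sw (\<lambda>y z. y \<otimes> S z) p)"
      by (rule sw_linear[symmetric]) (intro lin_intros | simp)+
    finally show ?thesis
      by (simp add: antipode_right smult_mult_right smult_smult mult.commute)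
  qed
  have collapse_left: "sw (\<lambda>x y. sw (\<lambda>u v. G x y z u v w) q) p =
      (counit H p * counit H q) \<odot> (S w \<otimes> S z)"
    if [simp]: "p \<in> carrier H" "q \<in> carrier H" "z \<in> carrier H" "w \<in> carrier H" for p q z w
  proof -
    have B: "bilin (\<lambda>x y. S x \<otimes> y \<otimes> (S w \<otimes> S z))"
      by (intro bilinear_onI lin_intros) simp_all
    have "sw (\<lambda>x y. sw (\<lambda>u v. G x y z u v w) q) p = sw (\<lambda>x y. S x \<otimes> y \<otimes> (S w \<otimes> S z)) (p \<otimes> q)"
      unfolding G_def by (rule sw_mult[OF B, symmetric]) simp_all
    also have "\<dots> = sw (\<lambda>x y. S x \<otimes> y) (p \<otimes> q) \<otimes> (S w \<otimes> S z)"
      by (rule sw_linear[symmetric]) (intro lin_intros | simp)+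
    finally show ?thesis
      by (simp add: antipode_left counit_mult smult_mult_left)
  qed
  have "S (a \<otimes> b) = S (sw (\<lambda>x p. counit H p \<odot> x) a \<otimes> sw (\<lambda>u q. counit H q \<odot> u) b)"
    by (simp add: counit_right a b)
  also have "\<dots> = sw (\<lambda>x p. S ((counit H p \<odot> x) \<otimes> sw (\<lambda>u q. counit H q \<odot> u) b)) a"
    by (rule sw_linear[where f = "\<lambda>t. S (t \<otimes> sw (\<lambda>u q. counit H q \<odot> u) b)"])
      (intro lin_intros sw_closed a b | simp)+
  also have "\<dots> = sw (\<lambda>x p. sw (\<lambda>u q. S ((counit H p \<odot> x) \<otimes> (counit H q \<odot> u))) b) a"
    by (intro sw_cong a, rule sw_linear) (intro lin_intros a b | simp)+
  also have "\<dots> = sw (\<lambda>x p. sw (\<lambda>u q. (counit H p * counit H q) \<odot> S (x \<otimes> u)) b) a"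
  proof (intro sw_cong a b)
    fix x p u q
    assume [simp]: "x \<in> carrier H" "p \<in> carrier H" "u \<in> carrier H" "q \<in> carrier H"
    show "S ((counit H p \<odot> x) \<otimes> (counit H q \<odot> u)) = (counit H p * counit H q) \<odot> S (x \<otimes> u)"
      by (simp add: smult_mult_left smult_mult_right linear_onD(3)[OF antipode_linear] smult_smult
          mult.commute)
  qed
  also have "\<dots> = sw (\<lambda>x p. sw (\<lambda>u q. sw (\<lambda>y z. sw (\<lambda>v w. G x y z u v w) q) p) b) a"
    by (intro sw_cong a b collapse_right[symmetric])
  also have "\<dots> = sw (\<lambda>x p. sw (\<lambda>y z. sw (\<lambda>u q. sw (\<lambda>v w. G x y z u v w) q) b) p) a"
    by (intro sw_cong a sw_swap b sw_closed G)
  \<comment> \<open>Rebracket the threefold coproduct of \<open>a\<close>, then that of \<open>b\<close>.\<close>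
  also have "\<dots> = sw (\<lambda>p z. sw (\<lambda>x y. sw (\<lambda>u q. sw (\<lambda>v w. G x y z u v w) q) b) p) a"
    unfolding G_def
    by (rule sw_coassoc[symmetric])
      (intro lin_intros bilinear_onI sw_closed a b | simp)+
  also have "\<dots> = sw (\<lambda>p z. sw (\<lambda>x y. sw (\<lambda>q w. sw (\<lambda>u v. G x y z u v w) q) b) p) a"
    unfolding G_def
    by (rule sw_cong[OF a], rule sw_cong, assumption, rule sw_coassoc[symmetric])
      (intro lin_intros bilinear_onI sw_closed a b | simp)+
  also have "\<dots> = sw (\<lambda>p z. sw (\<lambda>q w. sw (\<lambda>x y. sw (\<lambda>u v. G x y z u v w) q) p) b) a"
    by (intro sw_cong a sw_swap b sw_closed G)
  also have "\<dots> = sw (\<lambda>p z. sw (\<lambda>q w. (counit H p * counit H q) \<odot> (S w \<otimes> S z)) b) a"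
    by (intro sw_cong a b collapse_left)
  also have "\<dots> = sw (\<lambda>p z. sw (\<lambda>q w. S (counit H q \<odot> w) \<otimes> S (counit H p \<odot> z)) b) a"
  proof (intro sw_cong a b)
    fix p z q w
    assume [simp]: "p \<in> carrier H" "z \<in> carrier H" "q \<in> carrier H" "w \<in> carrier H"
    show "(counit H p * counit H q) \<odot> (S w \<otimes> S z) = S (counit H q \<odot> w) \<otimes> S (counit H p \<odot> z)"
      by (simp add: smult_mult_left smult_mult_right linear_onD(3)[OF antipode_linear] smult_smult
          mult.commute)
  qed
  also have "\<dots> = sw (\<lambda>p z. S (sw (\<lambda>q w. counit H q \<odot> w) b) \<otimes> S (counit H p \<odot> z)) a"
    by (intro sw_cong a, rule sw_linear[symmetric]) (intro lin_intros a b | simp)+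
  also have "\<dots> = S (sw (\<lambda>q w. counit H q \<odot> w) b) \<otimes> S (sw (\<lambda>p z. counit H p \<odot> z) a)"
    by (rule sw_linear[symmetric]) (intro lin_intros sw_closed a b antipode_closed | simp)+
  also have "\<dots> = S b \<otimes> S a"
    by (simp add: counit_left a b)
  finally show ?thesis .
qed

end

context hopf_star_algebra
begin

abbreviation Sbar :: "'h \<Rightarrow> 'h" where "Sbar a \<equiv> star H (S (star H a))"

lemma star_closed [simp]: "a \<in> carrier H \<Longrightarrow> star H a \<in> carrier H"
  by (rule antilinear_onD(1)[OF star_antilinear])

lemma star_one: "star H \<one> = \<one>"
  using star_mult[of "star H \<one>" \<one>] by (simp add: star_star)

text \<open>Two antilinear maps compose to a linear one.\<close>

lemma lin_star_conj [lin_intros]: "lin f \<Longrightarrow> lin g \<Longrightarrow> lin (\<lambda>x. star H (f (star H (g x))))"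
  using antilinear_onD[OF star_antilinear]
  by (intro linear_onI) (simp_all add: linear_onD)

lemma sw_star:
  assumes B: "bilin B" and a: "a \<in> carrier H"
  shows "sw B (star H a) = sw (\<lambda>x y. B (star H x) (star H y)) a"
proof -
  have T: "abelian_group (tensor H H)"
    using module_tensor[OF module_H module_H] by (rule module.axioms(2))
  have "sw B (star H a) = sw (\<lambda>x y. sweedler H B (pure_tensor H H (star H x) (star H y))) a"
    unfolding coprod_star[OF a] using a
    by (intro additive_sweedler[OF module_H module_H T abelian_group_H
          linear_imp_additive[OF sweedler_linear[OF module_H module_H module_H B]]])
      (simp_all add: pure_tensor_closed[OF module_H module_H])
  also have "\<dots> = sw (\<lambda>x y. B (star H x) (star H y)) a"
    using a by (intro sw_cong sweedler_pure_tensor[OF module_H module_H module_H B]) simp_all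
  finally show ?thesis .
qed

lemmas sw_star_out = sw_additive[OF antilinear_imp_additive[OF star_antilinear]]

text \<open>In the algebra of linear maps under convolution, \<open>S \<circ> Sbar\<close> is a left and the identity a right
  inverse of \<open>S\<close>.  The computation evaluates \<open>S (Sbar a\<^sub>1) S a\<^sub>2 a\<^sub>3\<close> in both bracketings.  In the second one the counit
  appears in the form \<open>\<eta> x = cnj (\<epsilon> (x\<^sup>*))\<close>; conjugating the counit axiom for \<open>a\<^sup>*\<close> shows that \<open>\<eta>\<close> may be
  contracted like \<open>\<epsilon>\<close>.\<close>

lemma antipode_conj_right_inverse:
  assumes a: "a \<in> carrier H"
  shows "S (Sbar a) = a"
proof -
  define \<eta> where "\<eta> x = cnj (counit H (star H x))" for x
  have B: "bilin (\<lambda>x y. S x \<otimes> y)"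
    by (intro bilinear_onI lin_intros) simp_all
  \<comment> \<open>The antipode axiom at \<open>p\<^sup>*\<close>, conjugated and then mapped by \<open>S\<close>.\<close>
  have inv: "sw (\<lambda>x y. S (Sbar x) \<otimes> S y) p = \<eta> p \<odot> \<one>" if [simp]: "p \<in> carrier H" for p
  proof -
    have "sw (\<lambda>x y. S (Sbar x) \<otimes> S y) p = sw (\<lambda>x y. S (star H (S (star H x) \<otimes> star H y))) p"
      by (intro sw_cong) (simp_all add: star_mult star_star antipode_mult)
    also have "\<dots> = S (sw (\<lambda>x y. star H (S (star H x) \<otimes> star H y)) p)"
      by (rule sw_linear[symmetric]) (intro lin_intros | simp)+
    also have "sw (\<lambda>x y. star H (S (star H x) \<otimes> star H y)) p =
        star H (sw (\<lambda>x y. S (star H x) \<otimes> star H y) p)"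
      by (rule sw_star_out[symmetric]) simp_all
    also have "sw (\<lambda>x y. S (star H x) \<otimes> star H y) p = counit H (star H p) \<odot> \<one>"
      using sw_star[OF B, of p] antipode_left[of "star H p"] by simp
    finally show ?thesis
      by (simp add: \<eta>_def antilinear_onD(3)[OF star_antilinear] star_one
          linear_onD(3)[OF antipode_linear] antipode_one)
  qed
  have "S (Sbar a) = S (Sbar (sw (\<lambda>x y. counit H y \<odot> x) a))"
    by (simp add: counit_right a)
  also have "\<dots> = sw (\<lambda>x y. S (Sbar (counit H y \<odot> x))) a"
    by (rule sw_linear) (intro lin_intros a | simp)+
  also have "\<dots> = sw (\<lambda>x y. sw (\<lambda>y1 y2. S (Sbar x) \<otimes> S y1 \<otimes> y2) y) a"
  proof (intro sw_cong a)
    fix x y assume [simp]: "x \<in> carrier H" "y \<in> carrier H"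
    have "sw (\<lambda>y1 y2. S (Sbar x) \<otimes> S y1 \<otimes> y2) y = sw (\<lambda>y1 y2. S (Sbar x) \<otimes> (S y1 \<otimes> y2)) y"
      by (intro sw_cong) (simp_all add: assoc_H)
    also have "\<dots> = S (Sbar x) \<otimes> sw (\<lambda>y1 y2. S y1 \<otimes> y2) y"
      by (rule sw_linear[symmetric]) (intro lin_intros | simp)+
    finally show "S (Sbar (counit H y \<odot> x)) = sw (\<lambda>y1 y2. S (Sbar x) \<otimes> S y1 \<otimes> y2) y"
      by (simp add: antipode_left smult_mult_right linear_onD(3)[OF antipode_linear]
          antilinear_onD(3)[OF star_antilinear])
  qed
  also have "\<dots> = sw (\<lambda>x y. sw (\<lambda>x1 x2. S (Sbar x1) \<otimes> S x2 \<otimes> y) x) a"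
    by (rule sw_coassoc[symmetric]) (intro lin_intros a | simp)+
  also have "\<dots> = sw (\<lambda>x y. star H (counit H (star H x) \<odot> star H y)) a"
  proof (intro sw_cong a)
    fix x y assume [simp]: "x \<in> carrier H" "y \<in> carrier H"
    have "sw (\<lambda>x1 x2. S (Sbar x1) \<otimes> S x2 \<otimes> y) x = sw (\<lambda>x1 x2. S (Sbar x1) \<otimes> S x2) x \<otimes> y"
      by (rule sw_linear[symmetric]) (intro lin_intros | simp)+
    then show "sw (\<lambda>x1 x2. S (Sbar x1) \<otimes> S x2 \<otimes> y) x = star H (counit H (star H x) \<odot> star H y)"
      by (simp add: inv \<eta>_def smult_mult_left star_star antilinear_onD(3)[OF star_antilinear])
  qed
  also have "\<dots> = star H (sw (\<lambda>x y. counit H (star H x) \<odot> star H y) a)"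
    by (rule sw_star_out[symmetric]) (simp_all add: a)
  also have "sw (\<lambda>x y. counit H (star H x) \<odot> star H y) a = sw (\<lambda>x y. counit H x \<odot> y) (star H a)"
    by (rule sw_star[symmetric]) (intro bilinear_onI lin_intros a | simp)+
  also have "star H \<dots> = a"
    by (simp add: counit_left star_star a)
  finally show ?thesis .
qed

text \<open>Conjugating \<open>S \<circ> Sbar = id\<close> by the involution turns it into \<open>Sbar \<circ> S = id\<close>.\<close>

lemma antipode_star_antipode_star:
  assumes "a \<in> carrier H"
  shows "star H (S (star H (S a))) = a"
  using antipode_conj_right_inverse[of "star H a"] assms by (metis star_star star_closed)

lemma antipode_bij: "bij_betw S (carrier H) (carrier H)"
  by (rule bij_betw_byWitness[where f' = Sbar])
    (auto simp: antipode_conj_right_inverse antipode_star_antipode_star)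

end

section \<open>Duals and conjugates of modules\<close>

lemma left_hmoduleI:
  assumes "Module.module cplx V"
    and "\<And>a. a \<in> carrier H \<Longrightarrow> linear_on V V (action V a)"
    and "\<And>v. v \<in> carrier V \<Longrightarrow> linear_on H V (\<lambda>a. action V a v)"
    and "\<And>a b v. a \<in> carrier H \<Longrightarrow> b \<in> carrier H \<Longrightarrow> v \<in> carrier V \<Longrightarrow>
      action V (a \<otimes>\<^bsub>H\<^esub> b) v = action V a (action V b v)"
    and "\<And>v. v \<in> carrier V \<Longrightarrow> action V \<one>\<^bsub>H\<^esub> v = v"
  shows "left_hmodule H V"
  using assms by (simp add: left_hmodule_def)

lemma left_hmoduleD:
  assumes "left_hmodule H V"
  shows "Module.module cplx V"
    and "a \<in> carrier H \<Longrightarrow> linear_on V V (action V a)"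
    and "v \<in> carrier V \<Longrightarrow> linear_on H V (\<lambda>a. action V a v)"
    and "a \<in> carrier H \<Longrightarrow> b \<in> carrier H \<Longrightarrow> v \<in> carrier V \<Longrightarrow>
      action V (a \<otimes>\<^bsub>H\<^esub> b) v = action V a (action V b v)"
    and "v \<in> carrier V \<Longrightarrow> action V \<one>\<^bsub>H\<^esub> v = v"
  using assms by (simp_all add: left_hmodule_def)

lemma action_closed:
  "left_hmodule H V \<Longrightarrow> a \<in> carrier H \<Longrightarrow> v \<in> carrier V \<Longrightarrow> action V a v \<in> carrier V"
  by (rule linear_onD(1)[OF left_hmoduleD(2)])

lemma lin_homI: "f \<in> extensional (carrier V) \<Longrightarrow> linear_on V W f \<Longrightarrow> f \<in> lin_hom V W"
  by (simp add: lin_hom_def)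

lemma lin_homD:
  assumes "f \<in> lin_hom V W"
  shows "f \<in> extensional (carrier V)" "linear_on V W f"
  using assms by (simp_all add: lin_hom_def)

lemmas functional_simps = linear_onD(2,3)[OF lin_homD(2), where W = cplx, unfolded cplx_simps]

lemma restrict_functionalI:
  assumes "Module.module cplx V"
    and "\<And>u v. u \<in> carrier V \<Longrightarrow> v \<in> carrier V \<Longrightarrow> g (u \<oplus>\<^bsub>V\<^esub> v) = g u + g v"
    and "\<And>c v. v \<in> carrier V \<Longrightarrow> g (c \<odot>\<^bsub>V\<^esub> v) = c * g v"
  shows "restrict g (carrier V) \<in> lin_hom V cplx"
proof -
  interpret V: Module.module cplx V by fact
  have "c \<odot>\<^bsub>V\<^esub> v \<in> carrier V" if "v \<in> carrier V" for c v
    using V.smult_closed[of c v] that by simp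
  then show ?thesis
    using assms(2,3) by (intro lin_homI linear_onI) simp_all
qed

definition algebra_antihom :: "('h, 'z) hopf_star_scheme \<Rightarrow> ('h \<Rightarrow> 'h) \<Rightarrow> bool"
  where "algebra_antihom H \<alpha> \<longleftrightarrow> linear_on H H \<alpha> \<and>
    (\<forall>a\<in>carrier H. \<forall>b\<in>carrier H. \<alpha> (a \<otimes>\<^bsub>H\<^esub> b) = \<alpha> b \<otimes>\<^bsub>H\<^esub> \<alpha> a) \<and> \<alpha> \<one>\<^bsub>H\<^esub> = \<one>\<^bsub>H\<^esub>"

text \<open>The left and the right dual are the cases \<open>\<alpha> = S\<close> and \<open>\<alpha> = S\<inverse>\<close> of one construction, which gives
  a left module for every anti-endomorphism \<open>\<alpha>\<close> of the algebra.\<close>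

definition twisted_dual :: "('h \<Rightarrow> 'h) \<Rightarrow> ('h, 'v) hmodule \<Rightarrow> ('h, 'v \<Rightarrow> complex) hmodule"
  where "twisted_dual \<alpha> V =
    \<lparr>carrier = lin_hom V cplx,
     mult = undefined, one = undefined,
     zero = (\<lambda>v\<in>carrier V. 0),
     add = (\<lambda>f g. \<lambda>v\<in>carrier V. f v + g v),
     smult = (\<lambda>c f. \<lambda>v\<in>carrier V. c * f v),
     action = (\<lambda>a f. \<lambda>v\<in>carrier V. f (action V (\<alpha> a) v))\<rparr>"

lemma left_dual_twisted: "left_dual H V = twisted_dual (antipode H) V"
  by (simp add: left_dual_def twisted_dual_def)

lemma right_dual_twisted: "right_dual H V = twisted_dual (inv_into (carrier H) (antipode H)) V"
  by (simp add: right_dual_def twisted_dual_def)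

lemma twisted_dual_simps [simp]:
  "carrier (twisted_dual \<alpha> V) = lin_hom V cplx"
  "\<zero>\<^bsub>twisted_dual \<alpha> V\<^esub> = (\<lambda>v\<in>carrier V. 0)"
  "f \<oplus>\<^bsub>twisted_dual \<alpha> V\<^esub> g = (\<lambda>v\<in>carrier V. f v + g v)"
  "c \<odot>\<^bsub>twisted_dual \<alpha> V\<^esub> f = (\<lambda>v\<in>carrier V. c * f v)"
  "action (twisted_dual \<alpha> V) a f = (\<lambda>v\<in>carrier V. f (action V (\<alpha> a) v))"
  by (simp_all add: twisted_dual_def)

lemma functional_eqI:
  assumes "f \<in> lin_hom V cplx" "g \<in> lin_hom V cplx"
    and "\<And>v. v \<in> carrier V \<Longrightarrow> f v = g v"
  shows "f = g"
  by (rule extensionalityI[OF lin_homD(1)[OF assms(1)] lin_homD(1)[OF assms(2)] assms(3)])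

lemma module_smult_closed:
  "Module.module cplx V \<Longrightarrow> v \<in> carrier V \<Longrightarrow> c \<odot>\<^bsub>V\<^esub> v \<in> carrier V"
  using module.smult_closed[of cplx V c v] by simp

lemma module_add_closed:
  "Module.module cplx V \<Longrightarrow> u \<in> carrier V \<Longrightarrow> v \<in> carrier V \<Longrightarrow> u \<oplus>\<^bsub>V\<^esub> v \<in> carrier V"
  using abelian_group.axioms(1)[OF module.axioms(2)] abelian_monoid.a_closed by metis

lemma module_twisted_dual:
  assumes V: "Module.module cplx V"
  shows "Module.module cplx (twisted_dual \<alpha> V)"
proof -
  have group: "abelian_group (twisted_dual \<alpha> V)"
  proof (rule abelian_groupI)
    fix f assume f: "f \<in> carrier (twisted_dual \<alpha> V)"
    have "(\<lambda>v\<in>carrier V. - f v) \<in> lin_hom V cplx"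
      using f by (intro restrict_functionalI[OF V]) (simp_all add: functional_simps)
    then show "\<exists>g\<in>carrier (twisted_dual \<alpha> V).
        g \<oplus>\<^bsub>twisted_dual \<alpha> V\<^esub> f = \<zero>\<^bsub>twisted_dual \<alpha> V\<^esub>"
      by (intro bexI[of _ "\<lambda>v\<in>carrier V. - f v"]) (auto intro!: restrict_ext)
    show "\<zero>\<^bsub>twisted_dual \<alpha> V\<^esub> \<oplus>\<^bsub>twisted_dual \<alpha> V\<^esub> f = f"
      using f lin_homD(1)[of f V cplx] by (auto simp: extensional_def)
  qed (auto intro!: restrict_functionalI[OF V] restrict_ext simp: functional_simps algebra_simps)
  note closed = module_smult_closed[OF V] module_add_closed[OF V]
  show ?thesis
    by (rule moduleI[OF module.axioms(1)[OF V] group])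
      (auto intro!: restrict_functionalI[OF V] restrict_ext
        simp: functional_simps algebra_simps closed extensional_restrict[OF lin_homD(1)])
qed

text \<open>Precomposition reverses the order of two actions, and \<open>\<alpha>\<close> reverses it back.\<close>

lemma left_hmodule_twisted_dual:
  assumes H: "ring H" and \<alpha>: "algebra_antihom H \<alpha>" and V: "left_hmodule H V"
  shows "left_hmodule H (twisted_dual \<alpha> V)"
proof (rule left_hmoduleI)
  interpret H: ring H by fact
  note mod = left_hmoduleD(1)[OF V]
  have lin\<alpha>: "linear_on H H \<alpha>"
    and mult\<alpha>: "\<And>a b. a \<in> carrier H \<Longrightarrow> b \<in> carrier H \<Longrightarrow> \<alpha> (a \<otimes>\<^bsub>H\<^esub> b) = \<alpha> b \<otimes>\<^bsub>H\<^esub> \<alpha> a"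
    and one\<alpha>: "\<alpha> \<one>\<^bsub>H\<^esub> = \<one>\<^bsub>H\<^esub>"
    using \<alpha> by (auto simp: algebra_antihom_def)
  note rules = linear_onD[OF lin\<alpha>] mult\<alpha> one\<alpha> linear_onD[OF left_hmoduleD(2)[OF V]]
    linear_onD(2,3)[OF left_hmoduleD(3)[OF V]] left_hmoduleD(4,5)[OF V] functional_simps
  have act: "action (twisted_dual \<alpha> V) a f \<in> lin_hom V cplx"
    if "a \<in> carrier H" "f \<in> lin_hom V cplx" for a f
    using that unfolding twisted_dual_simps
    by (intro restrict_functionalI[OF mod]) (simp_all add: rules)
  show "Module.module cplx (twisted_dual \<alpha> V)"
    by (rule module_twisted_dual[OF mod])
  show "linear_on (twisted_dual \<alpha> V) (twisted_dual \<alpha> V) (action (twisted_dual \<alpha> V) a)"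
    if "a \<in> carrier H" for a
    using that act[OF that] by (intro linear_onI) (auto intro!: restrict_ext simp: rules)
  show "linear_on H (twisted_dual \<alpha> V) (\<lambda>a. action (twisted_dual \<alpha> V) a f)"
    if "f \<in> carrier (twisted_dual \<alpha> V)" for f
    using that act[of _ f] by (intro linear_onI) (auto intro!: restrict_ext simp: rules)
  show "action (twisted_dual \<alpha> V) (a \<otimes>\<^bsub>H\<^esub> b) f =
      action (twisted_dual \<alpha> V) a (action (twisted_dual \<alpha> V) b f)"
    if "a \<in> carrier H" "b \<in> carrier H" "f \<in> carrier (twisted_dual \<alpha> V)" for a b f
    using that by (auto intro!: restrict_ext simp: rules)
  show "action (twisted_dual \<alpha> V) \<one>\<^bsub>H\<^esub> f = f" if "f \<in> carrier (twisted_dual \<alpha> V)" for f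
    using that act[OF H.one_closed, of f] by (intro functional_eqI[of _ V]) (auto simp: rules)
qed

lemma conj_hmod_simps [simp]:
  "carrier (conj_hmod H V) = Cbar ` carrier V"
  "\<zero>\<^bsub>conj_hmod H V\<^esub> = Cbar \<zero>\<^bsub>V\<^esub>"
  "x \<oplus>\<^bsub>conj_hmod H V\<^esub> y = Cbar (uncbar x \<oplus>\<^bsub>V\<^esub> uncbar y)"
  "c \<odot>\<^bsub>conj_hmod H V\<^esub> x = Cbar (cnj c \<odot>\<^bsub>V\<^esub> uncbar x)"
  "action (conj_hmod H V) a x = Cbar (action V (star H (antipode H a)) (uncbar x))"
  by (simp_all add: conj_hmod_def)

lemma module_conj_hmod:
  assumes "Module.module cplx V"
  shows "Module.module cplx (conj_hmod H V)"
proof -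
  interpret V: Module.module cplx V by fact
  have smult: "(c + d) \<odot>\<^bsub>V\<^esub> v = c \<odot>\<^bsub>V\<^esub> v \<oplus>\<^bsub>V\<^esub> d \<odot>\<^bsub>V\<^esub> v" "(c * d) \<odot>\<^bsub>V\<^esub> v = c \<odot>\<^bsub>V\<^esub> (d \<odot>\<^bsub>V\<^esub> v)"
      "1 \<odot>\<^bsub>V\<^esub> v = v"
    if "v \<in> carrier V" for c d v
    using that V.smult_l_distr[of c d v] V.smult_assoc1[of c d v] V.smult_one[of v] by simp_all
  have group: "abelian_group (conj_hmod H V)"
  proof (rule abelian_groupI)
    fix x assume "x \<in> carrier (conj_hmod H V)"
    then show "\<exists>y\<in>carrier (conj_hmod H V). y \<oplus>\<^bsub>conj_hmod H V\<^esub> x = \<zero>\<^bsub>conj_hmod H V\<^esub>"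
      by (auto intro!: bexI[of _ "Cbar (\<ominus>\<^bsub>V\<^esub> uncbar x)"] V.M.l_neg)
  qed (auto simp: V.M.a_ac)
  show ?thesis
    by (rule moduleI[OF V.R.is_cring group])
      (auto simp: smult V.smult_r_distr module_smult_closed[OF assms])
qed

context hopf_star_algebra
begin

lemma antipode_antihom: "algebra_antihom H S"
  by (simp add: algebra_antihom_def antipode_linear antipode_mult antipode_one)

abbreviation Sinv :: "'h \<Rightarrow> 'h" where "Sinv \<equiv> inv_into (carrier H) S"

lemma antipode_inverse_eq: "a \<in> carrier H \<Longrightarrow> Sinv a = Sbar a"
  using antipode_bij
  by (intro inv_into_f_eq) (auto simp: antipode_conj_right_inverse bij_betw_def)

lemma antipode_inverse_antihom: "algebra_antihom H Sinv"
proof -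
  have "lin (\<lambda>x. Sbar x)"
    by (intro lin_intros)
  then have "lin Sinv"
    by (simp add: linear_on_def antipode_inverse_eq Pi_iff)
  then show ?thesis
    by (simp add: algebra_antihom_def antipode_inverse_eq star_mult antipode_mult star_one antipode_one)
qed

lemma left_hmodule_left_dual: "left_hmodule H V \<Longrightarrow> left_hmodule H (left_dual H V)"
  unfolding left_dual_twisted by (rule left_hmodule_twisted_dual[OF ring_H antipode_antihom])

lemma left_hmodule_right_dual: "left_hmodule H V \<Longrightarrow> left_hmodule H (right_dual H V)"
  unfolding right_dual_twisted
  by (rule left_hmodule_twisted_dual[OF ring_H antipode_inverse_antihom])

text \<open>The map \<open>a \<mapsto> (S a)\<^sup>*\<close> preserves products, being a composite of two maps
  that reverse them, and it is antilinear, which matches the conjugate scalar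
  multiplication of the conjugate module.\<close>

lemma left_hmodule_conj:
  assumes V: "left_hmodule H V"
  shows "left_hmodule H (conj_hmod H V)"
proof (rule left_hmoduleI)
  show "Module.module cplx (conj_hmod H V)"
    by (rule module_conj_hmod[OF left_hmoduleD(1)[OF V]])
qed (auto intro!: linear_onI simp: linear_onD[OF antipode_linear] antilinear_onD[OF star_antilinear]
    linear_onD[OF left_hmoduleD(2)[OF V]] linear_onD(2,3)[OF left_hmoduleD(3)[OF V]]
    left_hmoduleD(4,5)[OF V] antipode_mult star_mult antipode_one star_one)

end

section \<open>Functoriality\<close>

lemma hmod_homI:
  assumes "T \<in> extensional (carrier V)" "linear_on V W T"
    and "\<And>a v. a \<in> carrier H \<Longrightarrow> v \<in> carrier V \<Longrightarrow> T (action V a v) = action W a (T v)"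
  shows "T \<in> hmod_hom H V W"
  using assms by (simp add: hmod_hom_def lin_hom_def)

lemma hmod_homD:
  assumes "T \<in> hmod_hom H V W"
  shows "T \<in> extensional (carrier V)" "linear_on V W T"
    and "a \<in> carrier H \<Longrightarrow> v \<in> carrier V \<Longrightarrow> T (action V a v) = action W a (T v)"
  using assms by (simp_all add: hmod_hom_def lin_hom_def)

lemma transpose_functional:
  assumes "Module.module cplx V" "linear_on V W T" "f \<in> lin_hom W cplx"
  shows "compose (carrier V) f T \<in> lin_hom V cplx"
  using assms(3) unfolding compose_def
  by (intro restrict_functionalI[OF assms(1)]) (simp_all add: linear_onD[OF assms(2)] functional_simps)

lemma transpose_map_hom:
  assumes V: "left_hmodule H V" and W: "left_hmodule H W" and T: "T \<in> hmod_hom H V W"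
    and \<alpha>: "\<alpha> \<in> carrier H \<rightarrow> carrier H"
  shows "transpose_map V W T \<in> hmod_hom H (twisted_dual \<alpha> W) (twisted_dual \<alpha> V)"
proof -
  note closed = linear_onD(1)[OF hmod_homD(2)[OF T]]
    module_smult_closed[OF left_hmoduleD(1)[OF W]] module_add_closed[OF left_hmoduleD(1)[OF W]]
    action_closed[OF V] action_closed[OF W] funcset_mem[OF \<alpha>]
  have tr: "compose (carrier V) f T \<in> lin_hom V cplx" if "f \<in> lin_hom W cplx" for f
    using that by (rule transpose_functional[OF left_hmoduleD(1)[OF V] hmod_homD(2)[OF T]])
  have val: "transpose_map V W T (restrict g (carrier W)) = (\<lambda>v\<in>carrier V. g (T v))"
    if "restrict g (carrier W) \<in> lin_hom W cplx" for g
    using that by (auto simp: transpose_map_def compose_def closed)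
  have dual: "Module.module cplx (twisted_dual \<alpha> W)"
    by (rule module_twisted_dual[OF left_hmoduleD(1)[OF W]])
  have add: "(\<lambda>v\<in>carrier W. f v + g v) \<in> lin_hom W cplx"
    if "f \<in> lin_hom W cplx" "g \<in> lin_hom W cplx" for f g
    using module_add_closed[OF dual, of f g] that by simp
  have smult: "(\<lambda>v\<in>carrier W. c * f v) \<in> lin_hom W cplx" if "f \<in> lin_hom W cplx" for c f
    using module_smult_closed[OF dual, of f c] that by simp
  have act: "(\<lambda>v\<in>carrier W. f (action W (\<alpha> a) v)) \<in> lin_hom W cplx"
    if "a \<in> carrier H" "f \<in> lin_hom W cplx" for a f
    using that by (intro restrict_functionalI[OF left_hmoduleD(1)[OF W]])
      (simp_all add: functional_simps closed linear_onD[OF left_hmoduleD(2)[OF W]])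
  show ?thesis
  proof (rule hmod_homI)
    show "transpose_map V W T \<in> extensional (carrier (twisted_dual \<alpha> W))"
      by (simp add: transpose_map_def)
    show "linear_on (twisted_dual \<alpha> W) (twisted_dual \<alpha> V) (transpose_map V W T)"
    proof (rule linear_onI)
      show "transpose_map V W T f \<in> carrier (twisted_dual \<alpha> V)"
        if "f \<in> carrier (twisted_dual \<alpha> W)" for f
        using that by (simp add: transpose_map_def tr)
    qed (simp_all add: val add smult, auto simp: transpose_map_def compose_def)
    show "transpose_map V W T (action (twisted_dual \<alpha> W) a f) =
        action (twisted_dual \<alpha> V) a (transpose_map V W T f)"
      if "a \<in> carrier H" "f \<in> carrier (twisted_dual \<alpha> W)" for a f
      using that by (auto simp: val act)
        (auto simp: transpose_map_def compose_def closed hmod_homD(3)[OF T])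
  qed
qed

lemma transpose_map_id: "transpose_map V V (\<lambda>v\<in>carrier V. v) = (\<lambda>f\<in>lin_hom V cplx. f)"
  by (auto simp: transpose_map_def compose_def fun_eq_iff lin_hom_def extensional_def)

lemma transpose_map_compose:
  assumes "Module.module cplx V" "linear_on U V S" "linear_on V W T"
  shows "transpose_map U W (compose (carrier U) T S) =
    compose (lin_hom W cplx) (transpose_map U V S) (transpose_map V W T)"
proof -
  have "compose (carrier U) f (compose (carrier U) T S) =
      compose (carrier U) (compose (carrier V) f T) S" for f
    using linear_onD(1)[OF assms(2)] by (auto simp: compose_def)
  then show ?thesis
    using transpose_functional[OF assms(1,3)]
    by (auto intro!: restrict_ext simp: transpose_map_def compose_def[of "lin_hom W cplx"])
qed

context hopf_star_algebra
begin

lemma conj_map_hom: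
  assumes V: "left_hmodule H V" and T: "T \<in> hmod_hom H V W"
  shows "conj_map V T \<in> hmod_hom H (conj_hmod H V) (conj_hmod H W)"
  by (rule hmod_homI)
    (auto intro!: linear_onI simp: conj_map_def hmod_homD(3)[OF T] linear_onD[OF hmod_homD(2)[OF T]]
      action_closed[OF V] module_smult_closed[OF left_hmoduleD(1)[OF V]]
      module_add_closed[OF left_hmoduleD(1)[OF V]])

end

lemma conj_map_id: "conj_map V (\<lambda>v\<in>carrier V. v) = (\<lambda>x\<in>Cbar ` carrier V. x)"
  by (auto intro!: restrict_ext simp: conj_map_def)

lemma conj_map_compose:
  assumes "linear_on U V S"
  shows "conj_map U (compose (carrier U) T S) =
    compose (Cbar ` carrier U) (conj_map V T) (conj_map U S)"
  using linear_onD(1)[OF assms] by (auto intro!: restrict_ext simp: conj_map_def compose_def)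

section \<open>The comparison maps\<close>

context hopf_star_algebra
begin

lemma b_map_apply:
  "f \<in> lin_hom V cplx \<Longrightarrow> v \<in> carrier V \<Longrightarrow> b_map V f (Cbar v) = cnj (f v)"
  by (simp add: b_map_def)

lemma b_map_closed:
  assumes "left_hmodule H V" "f \<in> lin_hom V cplx"
  shows "b_map V f \<in> lin_hom (conj_hmod H V) cplx"
proof -
  have "restrict (\<lambda>x. cnj (f (uncbar x))) (carrier (conj_hmod H V)) \<in> lin_hom (conj_hmod H V) cplx"
    by (rule restrict_functionalI[OF module_conj_hmod[OF left_hmoduleD(1)[OF assms(1)]]])
      (use assms(2) in \<open>auto simp: functional_simps\<close>)
  then show ?thesis
    using assms(2) by (simp add: b_map_def)
qed

lemma b_map_bij:
  assumes V: "left_hmodule H V"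
  shows "bij_betw (b_map V) (lin_hom V cplx) (lin_hom (conj_hmod H V) cplx)"
proof (rule bij_betw_byWitness[where f' = "\<lambda>g. \<lambda>v\<in>carrier V. cnj (g (Cbar v))"])
  have inv: "(\<lambda>v\<in>carrier V. cnj (g (Cbar v))) \<in> lin_hom V cplx"
    if g: "g \<in> lin_hom (conj_hmod H V) cplx" for g
  proof (rule restrict_functionalI[OF left_hmoduleD(1)[OF V]])
    show "cnj (g (Cbar (u \<oplus>\<^bsub>V\<^esub> v))) = cnj (g (Cbar u)) + cnj (g (Cbar v))"
      if "u \<in> carrier V" "v \<in> carrier V" for u v
      using functional_simps(1)[OF g, of "Cbar u" "Cbar v"] that by simp
    show "cnj (g (Cbar (c \<odot>\<^bsub>V\<^esub> v))) = c * cnj (g (Cbar v))" if "v \<in> carrier V" for c v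
      using functional_simps(2)[OF g, of "Cbar v" "cnj c"] that by simp
  qed
  then show "(\<lambda>g. \<lambda>v\<in>carrier V. cnj (g (Cbar v))) ` lin_hom (conj_hmod H V) cplx \<subseteq> lin_hom V cplx"
    by blast
  show "b_map V ` lin_hom V cplx \<subseteq> lin_hom (conj_hmod H V) cplx"
    using b_map_closed[OF V] by blast
  show "\<forall>f\<in>lin_hom V cplx. (\<lambda>v\<in>carrier V. cnj (b_map V f (Cbar v))) = f"
    by (auto simp: b_map_apply fun_eq_iff lin_hom_def extensional_def)
  show "\<forall>g\<in>lin_hom (conj_hmod H V) cplx. b_map V (\<lambda>v\<in>carrier V. cnj (g (Cbar v))) = g"
    using inv b_map_closed[OF V] by (auto intro!: functional_eqI[of _ "conj_hmod H V"] simp: b_map_apply)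
qed

lemma dual_simps [simp]:
  "carrier (left_dual H V) = lin_hom V cplx" "carrier (right_dual H V) = lin_hom V cplx"
  by (simp_all add: left_dual_def right_dual_def)

text \<open>The action of \<open>S\<inverse> c\<close> on the conjugate module is that of \<open>(S (S\<inverse> c))\<^sup>* = c\<^sup>*\<close> on \<open>V\<close>.  For
  \<open>c = (S a)\<^sup>*\<close> it is the action of \<open>S a\<close>, which also defines the left dual.\<close>

lemma b_map_antimodule:
  assumes V: "left_hmodule H V"
  shows "antimodule_map H (left_dual H V) (right_dual H (conj_hmod H V)) (b_map V)"
proof -
  let ?D = "left_dual H V" and ?D' = "right_dual H (conj_hmod H V)"
  have mods: "left_hmodule H ?D" "left_hmodule H ?D'"
    using V by (simp_all add: left_hmodule_left_dual left_hmodule_right_dual left_hmodule_conj)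
  have sinv: "S (Sinv a) = a" if "a \<in> carrier H" for a
    using that antipode_bij by (intro f_inv_into_f) (simp add: bij_betw_def)
  have sinv_closed: "Sinv a \<in> carrier H" if "a \<in> carrier H" for a
    using that by (simp add: antipode_inverse_eq)
  have b: "b_map V f \<in> carrier ?D'" if "f \<in> carrier ?D" for f
    using b_map_closed[OF V] that by simp
  note mods' = left_hmoduleD(1)[OF mods(1)] left_hmoduleD(1)[OF mods(2)]
  have eqI: "g = h"
    if "g \<in> carrier ?D'" "h \<in> carrier ?D'" "\<And>v. v \<in> carrier V \<Longrightarrow> g (Cbar v) = h (Cbar v)"
    for g h
    using that by (intro functional_eqI[of g "conj_hmod H V"]) auto
  have "antilinear_on ?D ?D' (b_map V)"
  proof (rule antilinear_onI)
    show "b_map V f \<in> carrier ?D'" if "f \<in> carrier ?D" for f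
      using that by (rule b)
    show "b_map V (f \<oplus>\<^bsub>?D\<^esub> g) = b_map V f \<oplus>\<^bsub>?D'\<^esub> b_map V g"
      if "f \<in> carrier ?D" "g \<in> carrier ?D" for f g
      using that module_add_closed[OF mods'(1) that]
      by (intro eqI b module_add_closed[OF mods'(2)])
        (simp_all add: b_map_apply, simp_all add: left_dual_twisted right_dual_twisted b_map_apply)
    show "b_map V (c \<odot>\<^bsub>?D\<^esub> f) = cnj c \<odot>\<^bsub>?D'\<^esub> b_map V f" if "f \<in> carrier ?D" for c f
      using that module_smult_closed[OF mods'(1) that]
      by (intro eqI b module_smult_closed[OF mods'(2)])
        (simp_all add: b_map_apply, simp_all add: left_dual_twisted right_dual_twisted b_map_apply)
  qed
  moreover have "b_map V (action ?D a f) = action ?D' (star H (S a)) (b_map V f)"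
    if "a \<in> carrier H" "f \<in> carrier ?D" for a f
  proof (rule eqI)
    show "b_map V (action ?D a f) \<in> carrier ?D'" "action ?D' (star H (S a)) (b_map V f) \<in> carrier ?D'"
      using that by (intro b action_closed[OF mods(1)] action_closed[OF mods(2)]; simp)+
    fix v assume v: "v \<in> carrier V"
    have "b_map V (action ?D a f) (Cbar v) = cnj (f (action V (S a) v))"
      using that v action_closed[OF mods(1) that]
      by (simp add: b_map_apply) (simp add: left_dual_twisted)
    also have "\<dots> = cnj (f (action V (star H (S (Sinv (star H (S a))))) v))"
      using that by (simp add: sinv star_star)
    also have "\<dots> = action ?D' (star H (S a)) (b_map V f) (Cbar v)"
      using that v sinv_closed[of "star H (S a)"]
      by (simp add: right_dual_twisted b_map_apply action_closed[OF V])
    finally show "b_map V (action ?D a f) (Cbar v) = action ?D' (star H (S a)) (b_map V f) (Cbar v)" .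
  qed
  ultimately show ?thesis
    using mods by (simp add: antimodule_map_def)
qed

lemma beta_map_apply: "f \<in> lin_hom V cplx \<Longrightarrow> beta_map V (Cbar f) = b_map V f"
  by (simp add: beta_map_def compose_def)

text \<open>The conjugate of the left dual has \<open>a\<close> act as \<open>(S a)\<^sup>*\<close>, and \<open>b_map\<close> replaces this element by
  \<open>(S ((S a)\<^sup>*))\<^sup>* = a\<close>.\<close>

lemma beta_map_iso:
  assumes V: "left_hmodule H V"
  shows "hmod_iso H (conj_hmod H (left_dual H V)) (right_dual H (conj_hmod H V)) (beta_map V)"
proof -
  let ?D = "left_dual H V" and ?D' = "right_dual H (conj_hmod H V)"
  have anti: "antilinear_on ?D ?D' (b_map V)"
    and act: "\<And>a f. a \<in> carrier H \<Longrightarrow> f \<in> carrier ?D \<Longrightarrow>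
        b_map V (action ?D a f) = action ?D' (star H (S a)) (b_map V f)"
    and D: "left_hmodule H ?D" and D': "left_hmodule H ?D'"
    using b_map_antimodule[OF V] by (auto simp: antimodule_map_def)
  have beta: "beta_map V (Cbar f) = b_map V f" if "f \<in> carrier ?D" for f
    using that by (simp add: beta_map_apply)
  have "beta_map V \<in> hmod_hom H (conj_hmod H ?D) ?D'"
  proof (rule hmod_homI)
    show "beta_map V \<in> extensional (carrier (conj_hmod H ?D))"
      by (simp add: beta_map_def)
    show "linear_on (conj_hmod H ?D) ?D' (beta_map V)"
      using antilinear_onD[OF anti] module_add_closed[OF left_hmoduleD(1)[OF D]]
        module_smult_closed[OF left_hmoduleD(1)[OF D]]
      by (intro linear_onI) (auto simp: beta_map_apply)
    show "beta_map V (action (conj_hmod H ?D) a x) = action ?D' a (beta_map V x)"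
      if a: "a \<in> carrier H" and x: "x \<in> carrier (conj_hmod H ?D)" for a x
    proof -
      obtain f where f: "x = Cbar f" "f \<in> carrier ?D"
        using x by auto
      have "beta_map V (action (conj_hmod H ?D) a x) = b_map V (action ?D (star H (S a)) f)"
        using a f action_closed[OF D, of "star H (S a)" f] by (simp add: beta)
      also have "\<dots> = action ?D' (star H (S (star H (S a)))) (b_map V f)"
        using a f by (intro act) simp_all
      finally show ?thesis
        using a f by (simp add: antipode_star_antipode_star beta)
    qed
  qed
  moreover have "bij_betw (beta_map V) (carrier (conj_hmod H ?D)) (carrier ?D')"
  proof -
    have "bij_betw uncbar (Cbar ` lin_hom V cplx) (lin_hom V cplx)"
      by (rule bij_betw_byWitness[where f' = Cbar]) auto
    from bij_betw_trans[OF this b_map_bij[OF V]]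
    have "bij_betw (b_map V \<circ> uncbar) (Cbar ` lin_hom V cplx) (lin_hom (conj_hmod H V) cplx)" .
    then show ?thesis
      by (subst bij_betw_cong[where g = "b_map V \<circ> uncbar"]) (auto simp: beta_map_apply)
  qed
  ultimately show ?thesis
    by (simp add: hmod_iso_def left_hmodule_conj D D')
qed

text \<open>At a functional \<open>f\<close>, both sides are the function sending the conjugate of \<open>v\<close> to the conjugate of
  \<open>f (T v)\<close>.\<close>

lemma beta_map_natural:
  assumes V: "left_hmodule H V" and W: "left_hmodule H W" and T: "T \<in> hmod_hom H V W"
  shows "compose (carrier (conj_hmod H (left_dual H W)))
      (beta_map V) (conj_map (left_dual H W) (transpose_map V W T)) =
    compose (carrier (conj_hmod H (left_dual H W)))
      (transpose_map (conj_hmod H V) (conj_hmod H W) (conj_map V T)) (beta_map W)"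
proof -
  have "beta_map V (conj_map (left_dual H W) (transpose_map V W T) (Cbar f)) =
      transpose_map (conj_hmod H V) (conj_hmod H W) (conj_map V T) (beta_map W (Cbar f))"
    if f: "f \<in> lin_hom W cplx" for f
  proof -
    have "compose (carrier V) f T \<in> lin_hom V cplx"
      by (rule transpose_functional[OF left_hmoduleD(1)[OF V] hmod_homD(2)[OF T] f])
    then have "beta_map V (conj_map (left_dual H W) (transpose_map V W T) (Cbar f)) =
        b_map V (compose (carrier V) f T)"
      using f by (simp add: conj_map_def transpose_map_def beta_map_apply)
    also have "\<dots> = compose (Cbar ` carrier V) (b_map W f) (conj_map V T)"
      using f transpose_functional[OF left_hmoduleD(1)[OF V] hmod_homD(2)[OF T] f]
        linear_onD(1)[OF hmod_homD(2)[OF T]]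
      by (auto intro!: restrict_ext simp: b_map_def compose_def conj_map_def)
    also have "\<dots> = transpose_map (conj_hmod H V) (conj_hmod H W) (conj_map V T) (beta_map W (Cbar f))"
      using f b_map_closed[OF W f] by (simp add: transpose_map_def beta_map_apply)
    finally show ?thesis .
  qed
  then show ?thesis
    by (auto intro!: restrict_ext simp: compose_def)
qed

lemma conj_left_dual_functor:
  "contravariant_functor H (\<lambda>U :: ('h, 'u) hmodule. conj_hmod H (left_dual H U))
    (\<lambda>U U' T. conj_map (left_dual H U') (transpose_map U U' T))"
  unfolding contravariant_functor_def
proof (intro conjI allI impI)
  fix V W :: "('h, 'u) hmodule" and B :: "'u \<Rightarrow> 'u"
  assume V: "left_hmodule H V"
  have S: "S \<in> carrier H \<rightarrow> carrier H" by simp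
  show "left_hmodule H (conj_hmod H (left_dual H V))"
    by (intro left_hmodule_conj left_hmodule_left_dual V)
  show "conj_map (left_dual H V) (transpose_map V V (\<lambda>v\<in>carrier V. v)) =
      (\<lambda>x\<in>carrier (conj_hmod H (left_dual H V)). x)"
    using conj_map_id[of "left_dual H V"] by (simp add: transpose_map_id)
  assume W: "left_hmodule H W" and B: "B \<in> hmod_hom H V W"
  show "conj_map (left_dual H W) (transpose_map V W B)
      \<in> hmod_hom H (conj_hmod H (left_dual H W)) (conj_hmod H (left_dual H V))"
    using transpose_map_hom[OF V W B S]
    by (intro conj_map_hom left_hmodule_left_dual W) (simp add: left_dual_twisted)
next
  fix U V W :: "('h, 'u) hmodule" and A B :: "'u \<Rightarrow> 'u"
  assume V: "left_hmodule H V" and W: "left_hmodule H W"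
    and A: "A \<in> hmod_hom H U V" and B: "B \<in> hmod_hom H V W"
  have S: "S \<in> carrier H \<rightarrow> carrier H" by simp
  show "conj_map (left_dual H W) (transpose_map U W (compose (carrier U) B A)) =
      compose (carrier (conj_hmod H (left_dual H W)))
        (conj_map (left_dual H V) (transpose_map U V A))
        (conj_map (left_dual H W) (transpose_map V W B))"
    unfolding transpose_map_compose[OF left_hmoduleD(1)[OF V] hmod_homD(2)[OF A] hmod_homD(2)[OF B]]
    using conj_map_compose[OF hmod_homD(2)[OF transpose_map_hom[OF V W B S]], of "transpose_map U V A"]
    by (simp add: left_dual_twisted)
qed

lemma right_dual_conj_functor:
  "contravariant_functor H (\<lambda>U :: ('h, 'u) hmodule. right_dual H (conj_hmod H U))
    (\<lambda>U U' T. transpose_map (conj_hmod H U) (conj_hmod H U') (conj_map U T))"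
  unfolding contravariant_functor_def
proof (intro conjI allI impI)
  fix V W :: "('h, 'u) hmodule" and B :: "'u \<Rightarrow> 'u"
  assume V: "left_hmodule H V"
  have Sinv: "Sinv \<in> carrier H \<rightarrow> carrier H" by (simp add: antipode_inverse_eq)
  show "left_hmodule H (right_dual H (conj_hmod H V))"
    by (intro left_hmodule_conj left_hmodule_right_dual V)
  show "transpose_map (conj_hmod H V) (conj_hmod H V) (conj_map V (\<lambda>v\<in>carrier V. v)) =
      (\<lambda>x\<in>carrier (right_dual H (conj_hmod H V)). x)"
    using transpose_map_id[of "conj_hmod H V"] by (simp add: conj_map_id)
  assume W: "left_hmodule H W" and B: "B \<in> hmod_hom H V W"
  show "transpose_map (conj_hmod H V) (conj_hmod H W) (conj_map V B)
      \<in> hmod_hom H (right_dual H (conj_hmod H W)) (right_dual H (conj_hmod H V))"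
    unfolding right_dual_twisted
    by (intro transpose_map_hom left_hmodule_conj conj_map_hom V W B Sinv)
next
  fix U V W :: "('h, 'u) hmodule" and A B :: "'u \<Rightarrow> 'u"
  assume U: "left_hmodule H U" and V: "left_hmodule H V" and W: "left_hmodule H W"
    and A: "A \<in> hmod_hom H U V" and B: "B \<in> hmod_hom H V W"
  show "transpose_map (conj_hmod H U) (conj_hmod H W) (conj_map U (compose (carrier U) B A)) =
      compose (carrier (right_dual H (conj_hmod H W)))
        (transpose_map (conj_hmod H U) (conj_hmod H V) (conj_map U A))
        (transpose_map (conj_hmod H V) (conj_hmod H W) (conj_map V B))"
    unfolding conj_map_compose[OF hmod_homD(2)[OF A]]
    using transpose_map_compose[OF left_hmoduleD(1)[OF left_hmodule_conj[OF V]]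
        hmod_homD(2)[OF conj_map_hom[OF U A]] hmod_homD(2)[OF conj_map_hom[OF V B]]]
    by simp
qed

end

theorem proposition4p9:
  fixes H :: "'h hopf_star"
    and V :: "('h, 'v) hmodule"
    and W :: "('h, 'w) hmodule"
  assumes "hopf_star_algebra H"
    and "left_hmodule H V"
    and "left_hmodule H W"
  shows
    "(antimodule_map H (left_dual H V) (right_dual H (conj_hmod H V)) (b_map V) \<and>
      bij_betw (b_map V) (carrier (left_dual H V)) (carrier (right_dual H (conj_hmod H V)))) \<and>
     hmod_iso H (conj_hmod H (left_dual H V)) (right_dual H (conj_hmod H V)) (beta_map V) \<and>
     (\<forall>T\<in>hmod_hom H V W.
       compose (carrier (conj_hmod H (left_dual H W)))
         (beta_map V) (conj_map (left_dual H W) (transpose_map V W T)) =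
       compose (carrier (conj_hmod H (left_dual H W)))
         (transpose_map (conj_hmod H V) (conj_hmod H W) (conj_map V T)) (beta_map W)) \<and>
     natural_equivalence H
       (\<lambda>U :: ('h, 'u) hmodule. conj_hmod H (left_dual H U))
       (\<lambda>U U' T. conj_map (left_dual H U') (transpose_map U U' T))
       (\<lambda>U. right_dual H (conj_hmod H U))
       (\<lambda>U U' T. transpose_map (conj_hmod H U) (conj_hmod H U') (conj_map U T))
       beta_map"
proof -
  interpret hopf_star_algebra H by fact
  note V = \<open>left_hmodule H V\<close> and W = \<open>left_hmodule H W\<close>
  show ?thesis
  proof (intro conjI ballI)
    show "antimodule_map H (left_dual H V) (right_dual H (conj_hmod H V)) (b_map V)"
      by (rule b_map_antimodule[OF V])
    show "bij_betw (b_map V) (carrier (left_dual H V)) (carrier (right_dual H (conj_hmod H V)))"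
      using b_map_bij[OF V] by simp
    show "hmod_iso H (conj_hmod H (left_dual H V)) (right_dual H (conj_hmod H V)) (beta_map V)"
      by (rule beta_map_iso[OF V])
    show "compose (carrier (conj_hmod H (left_dual H W)))
        (beta_map V) (conj_map (left_dual H W) (transpose_map V W T)) =
      compose (carrier (conj_hmod H (left_dual H W)))
        (transpose_map (conj_hmod H V) (conj_hmod H W) (conj_map V T)) (beta_map W)"
      if "T \<in> hmod_hom H V W" for T
      by (rule beta_map_natural[OF V W that])
    show "natural_equivalence H
       (\<lambda>U :: ('h, 'u) hmodule. conj_hmod H (left_dual H U))
       (\<lambda>U U' T. conj_map (left_dual H U') (transpose_map U U' T))
       (\<lambda>U. right_dual H (conj_hmod H U))
       (\<lambda>U U' T. transpose_map (conj_hmod H U) (conj_hmod H U') (conj_map U T))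
       beta_map"
      unfolding natural_equivalence_def
      by (intro conjI allI impI conj_left_dual_functor right_dual_conj_functor
          beta_map_iso beta_map_natural)
  qed
qed

end
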